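(* Let $T\in(0,\infty)$, $d\in\mathbb{N}$. Let $u\mapsto\nu_0^u\in\mathcal{P}(\mathbb{R}^d)$ be a Borel measurable map on $[0,1]$ and let $\tilde K_1:[0,1]\to\mathcal{M}^b_+([0,1])$ be an interaction kernel as in the context. Assume: (H1) For all $u\in[0,1]$, $\nu_0^u(dx)=v_0^u(x)\,dx$ for some Borel measurable function $(u,x)\mapsto v_0^u(x)$, $[0,1]\times\mathbb{R}^d\to[0,\infty)$, with $\|v_0\|_{L^\infty([0,1]\times\mathbb{R}^d)}<\infty$. (H2) $\varphi\mapsto(u\mapsto\langle\tilde K_1(u),\varphi\rangle)$ is a bounded linear operator from $L^1([0,1])$ to $L^1([0,1])$, and there exists $\alpha_0\in(0,1]$ such that $\int_0^1\|\tilde K_1(u+\kappa)-\tilde K_1(u)\|_{\mathrm{TV}}^{\alpha_0}\,du\to0$ as $|\kappa|\to0$, where $\tilde K_1(u+\kappa):=\tilde K_1(u)$ whenever $u+\kappa\notin[0,1]$. Let $b:[0,T]\times\mathbb{R}^d\times\mathbb{R}\to\mathbb{R}^d$ be Borel measurable with $b\in L^\infty([0,T]\times\mathbb{R}^d\times\mathbb{R};\mathbb{R}^d)$ and such that for some $C>0$, $\alpha\in(0,1]$, $|b(t,x,r)-b(t,x,\bar r)|\le C|r-\bar r|^\alpha$ for all $(t,x,r,\bar r)\in[0,T]\times\mathbb{R}^d\times\mathbb{R}\times\mathbb{R}$. Assume furthermore that there exist an at most countable index set $J$ and pairwise disjoint sets $A_j\in\mathcal{B}([0,1])$, $j\in J$,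 with $\bigcup_{j\in J}A_j=[0,1]$, such that for every $j\in J$ the map $A_j\ni u\mapsto(\nu_0^u,\tilde K_1(u))$ is constant. Let $(p^u_t)$ be the solution, with initial condition $(\nu_0^u)_{u\in[0,1]}$, to $$\partial_tp^u_t(x)=-\mathrm{div}\big(b(t,x,\langle\tilde K_1(u),p^\bullet_t(x)\rangle)p^u_t(x)\big)+\Delta p^u_t(x),\quad(t,x)\in[0,T]\times\mathbb{R}^d,\ u\in[0,1],$$ obtained as a limit of the Euler scheme, as described in the context. Then, for every $t\in(0,T]$ and $y\in\mathbb{R}^d$, $$\int_{A_j}\int_{A_j}|p^u_t(y)-p^v_t(y)|\,dv\,du=0\qquad\forall j\in J.$$ In particular, for every $j\in J$ the (continuous) map $(0,T]\times\mathbb{R}^d\ni(t,y)\mapsto p^\cdot_t(y)|_{A_j}\in L^1(A_j)$ takes values in the classes of $du$-a.e. constant functions on $A_j$.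
   Context: **Kernel.** $\mathcal{P}(E)$ denotes the Borel probability measures on a metric space $E$ with the topology of weak convergence. $\mathcal{M}^b_+([0,1])$ is the set of nonnegative finite Borel measures on $[0,1]$ with the total variation norm $\|\cdot\|_{\mathrm{TV}}$; $\langle\mu,\varphi\rangle:=\int\varphi\,d\mu$. An interaction kernel is a Borel measurable map $\tilde K_1:[0,1]\to\mathcal{M}^b_+([0,1])$ such that whenever $\varphi=\bar\varphi$ a.e. on $[0,1]$ then $\langle\tilde K_1(u),\varphi\rangle=\langle\tilde K_1(u),\bar\varphi\rangle$ for a.e. $u$. If $\varphi\mapsto\langle\tilde K_1(\cdot),\varphi\rangle$ is bounded on $L^q([0,1])$ for some $q\in[1,\infty)$ and $(u,x)\mapsto p^u_t(x)$ lies in $L^q_{\mathrm{loc}}([0,1]\times\mathbb{R}^d)$, then $(u,x)\mapsto\langle\tilde K_1(u),p^\bullet_t(x)\rangle$ ($\bullet$ is the integration variable) is a well-defined element of $L^q_{\mathrm{loc}}([0,1]\times\mathbb{R}^d)$; one always uses its Lebesgue version (value at Lebesgue points, $0$ elsewhere). **Solution of the Fokker--Planck system** with initial condition $(\nu^u_0)$: a family of probability densities $p^u_t$ on $\mathbb{R}^d$ such that (i) $u\mapsto\nu^u_0$ is Borel; (ii) $[(t,x,u)\mapsto p^u_t(x)]\in L^1_{\mathrm{loc}}([0,T]\times\mathbb{R}^d\times[0,1])$; (iii) $t\mapsto 1_{\{0\}}(t)\nu_0^u(dx)du+1_{(0,T]}(t)p^u_t(x)dxdu\in\mathcal{P}(\mathbb{R}^d\times[0,1])$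 is weakly continuous on $[0,T]$; (iv) $\langle\tilde K_1(u),p^\bullet_t(x)\rangle<\infty$ for $p^u_t(x)dxdudt$-a.e. $(x,u,t)$; (v) $\int_0^T\int_0^1\int_{\mathbb{R}^d}\big(|b(t,x,\langle\tilde K_1(u),p^\bullet_t(x)\rangle)|+1\big)p^u_t(x)dxdudt<\infty$; (vi) for all $\varphi\in C_c^\infty([0,T)\times\mathbb{R}^d\times(0,1))$, $$\int_0^T\!\!\int_0^1\!\!\int_{\mathbb{R}^d}\big[\partial_t\varphi+b(t,x,\langle\tilde K_1(u),p^\bullet_t(x)\rangle)\cdot\nabla_x\varphi+\Delta_x\varphi\big]p^u_t(x)\,dxdudt+\int_0^1\!\!\int_{\mathbb{R}^d}\varphi(0,x,u)\nu^u_0(dx)du=0.$$ **Euler scheme and the solution in the claim.** On a complete filtered probability space $(\Omega,\mathcal{F},\mathbb{P};(\mathcal{F}_t))$ (usual conditions) let $W$ be a $d$-dimensional $(\mathcal{F}_t)$-Wiener process and $(X^u_0)_{u\in[0,1]}$ $\mathcal{F}_0$-measurable random variables with law $\nu_0^u$ and $(u,\omega)\mapsto X^u_0(\omega)$ $\mathcal{B}([0,1])\otimes\mathcal{F}$-measurable. For $N\in\mathbb{N}$, $h:=T/N$, set $X^{u,N}(t):=X^u_0+\sqrt2W(t)$ for $t\in[0,h]$, and inductively for $t\in[kh,(k+1)h]$, $1\le k\le N-1$, $$X^{u,N}(t):=X^{u,N}(kh)+\int_{kh}^tb\big(s,X^{u,N}(kh),\langle\tilde K_1(u),p^{\bullet,N}_{kh}(X^{u,N}(kh))\rangle\big)ds+\sqrt2(W(t)-W(kh)),$$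 where $p^{u,N}_t$ ($t\in(0,T]$) is the (continuous in space) Lebesgue density of the law of $X^{u,N}(t)$. The solution in the claim is a solution $p\in C((0,T]\times\mathbb{R}^d;L^1([0,1]))$, $(t,y)\mapsto p_t^\cdot(y)$, for which there is a subsequence $N_k\to\infty$ with, for every $M\in\mathbb{N}$, $M>1/T$, $$\lim_{k\to\infty}\sup_{|y|\le M}\sup_{1/M\le t\le T}\|p^{\cdot,N_k}_t(y)-p^\cdot_t(y)\|_{L^1([0,1])}=0.$$ Such a solution exists under (H1), (H2) and the assumptions on $b$. *)

theory Defs
  imports "HOL-Probability.Probability"
begin

section \<open>Spaces of measures\<close>

abbreviation unit_borel :: "real measure" where
  "unit_borel \<equiv> restrict_space borel {0..1}"

abbreviation unit_lborel :: "real measure" where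
  "unit_lborel \<equiv> restrict_space lborel {0..1}"

definition borel_of_topology :: "'a topology \<Rightarrow> 'a measure" where
  "borel_of_topology X = sigma (topspace X) {U. openin X U}"

definition prob_measures_on :: "'a::metric_space set \<Rightarrow> 'a measure set" where
  "prob_measures_on E = {\<mu>. prob_space \<mu> \<and> sets \<mu> = sets (restrict_space borel E)}"

text \<open>The topology of weak convergence: the coarsest one for which integration against every
  bounded continuous real function is continuous.\<close>

definition weak_topology :: "'a::metric_space set \<Rightarrow> 'a measure topology" where
  "weak_topology E = topology_generated_by
     {{\<mu> \<in> prob_measures_on E. (LINT x|\<mu>. f x) \<in> U} | (f :: 'a \<Rightarrow> real) U.
        continuous_on E f \<and> bounded (f ` E) \<and> open U}"

definition unit_measures :: "real measure set" where
  "unit_measures = {\<mu>. finite_measure \<mu> \<and> sets \<mu> = sets unit_borel}"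

text \<open>Total variation norm of the signed measure \<open>\<mu> - \<nu>\<close>. The supremum is formed in
  \<open>ennreal\<close>; it is finite for members of \<open>unit_measures\<close>.\<close>

definition tv_dist :: "real measure \<Rightarrow> real measure \<Rightarrow> real" where
  "tv_dist \<mu> \<nu> = enn2real
     (SUP P\<in>{P. finite P \<and> disjoint P \<and> P \<subseteq> sets unit_borel \<and> \<Union>P = {0..1}}.
        \<Sum>A\<in>P. ennreal \<bar>measure \<mu> A - measure \<nu> A\<bar>)"

definition tv_topology :: "real measure topology" where
  "tv_topology = Metric_space.mtopology unit_measures tv_dist"

lemma tv_sum_bound:
  assumes "\<mu> \<in> unit_measures" "\<nu> \<in> unit_measures"
    and "finite P" "disjoint P" "P \<subseteq> sets unit_borel" "\<Union>P = {0..1}"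
  shows "(\<Sum>A\<in>P. \<bar>measure \<mu> A - measure \<nu> A\<bar>) \<le> measure \<mu> {0..1} + measure \<nu> {0..1}"
proof -
  have *: "(\<Sum>A\<in>P. measure m A) = measure m {0..1}" if "m \<in> unit_measures" for m
  proof -
    interpret finite_measure m using that by (simp add: unit_measures_def)
    have "(\<Sum>A\<in>P. measure m A) = measure m (\<Union>A\<in>P. A)"
      using assms that
      by (intro finite_measure_finite_Union[symmetric])
        (auto simp: unit_measures_def disjoint_family_on_def disjoint_def)
    then show ?thesis using assms by simp
  qed
  have "(\<Sum>A\<in>P. \<bar>measure \<mu> A - measure \<nu> A\<bar>) \<le> (\<Sum>A\<in>P. measure \<mu> A + measure \<nu> A)"
    by (intro sum_mono) (smt (verit) measure_nonneg)
  then show ?thesis using * assms(1,2) by (simp add: sum.distrib)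
qed

lemma tv_sum_le:
  assumes "\<mu> \<in> unit_measures" "\<nu> \<in> unit_measures"
    and "finite P" "disjoint P" "P \<subseteq> sets unit_borel" "\<Union>P = {0..1}"
  shows "(\<Sum>A\<in>P. \<bar>measure \<mu> A - measure \<nu> A\<bar>) \<le> tv_dist \<mu> \<nu>"
proof -
  let ?S = "{P. finite P \<and> disjoint P \<and> P \<subseteq> sets unit_borel \<and> \<Union>P = {0..1::real}}"
  let ?f = "\<lambda>P. \<Sum>A\<in>P. ennreal \<bar>measure \<mu> A - measure \<nu> A\<bar>"
  have "(SUP P\<in>?S. ?f P) \<le> ennreal (measure \<mu> {0..1} + measure \<nu> {0..1})"
    using tv_sum_bound[OF assms(1,2)] by (auto intro!: SUP_least simp: sum_ennreal ennreal_leI simp del: ennreal_plus)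
  then have fin: "(SUP P\<in>?S. ?f P) < \<top>"
    by (rule le_less_trans) simp
  have "?f P \<le> (SUP P\<in>?S. ?f P)"
    using assms by (intro SUP_upper) auto
  then have "enn2real (?f P) \<le> enn2real (SUP P\<in>?S. ?f P)"
    using fin by (intro enn2real_mono)
  then show ?thesis
    by (simp add: tv_dist_def sum_ennreal sum_nonneg)
qed

lemma tv_dist_leI:
  assumes "\<And>P. finite P \<Longrightarrow> disjoint P \<Longrightarrow> P \<subseteq> sets unit_borel \<Longrightarrow> \<Union>P = {0..1} \<Longrightarrow>
      (\<Sum>A\<in>P. \<bar>measure \<mu> A - measure \<nu> A\<bar>) \<le> c" and "0 \<le> c"
  shows "tv_dist \<mu> \<nu> \<le> c"
  unfolding tv_dist_def using assms
  by (intro enn2real_leI SUP_least) (auto simp: sum_ennreal ennreal_leI)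

lemma Metric_space_tv: "Metric_space unit_measures tv_dist"
proof
  show "0 \<le> tv_dist x y" for x y by (simp add: tv_dist_def)
  show "tv_dist x y = tv_dist y x" for x y by (simp add: tv_dist_def abs_minus_commute)
next
  fix x y assume xy: "x \<in> unit_measures" "y \<in> unit_measures"
  interpret x: finite_measure x using xy by (simp add: unit_measures_def)
  interpret y: finite_measure y using xy by (simp add: unit_measures_def)
  show "tv_dist x y = 0 \<longleftrightarrow> x = y"
  proof
    assume 0: "tv_dist x y = 0"
    show "x = y"
    proof (rule measure_eqI)
      show "sets x = sets y" using xy by (simp add: unit_measures_def)
      fix A assume "A \<in> sets x"
      then have A: "A \<in> sets unit_borel" using xy by (simp add: unit_measures_def)
      have sub: "A \<subseteq> {0..1}" using sets.sets_into_space[OF A] by simp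
      have C: "{0..1} - A \<in> sets unit_borel"
        using sets.compl_sets[OF A] by simp
      have "(\<Sum>B\<in>{A, {0..1} - A}. \<bar>measure x B - measure y B\<bar>) \<le> tv_dist x y"
        using A C sub by (intro tv_sum_le xy) (auto simp: disjoint_def)
      then have "\<bar>measure x A - measure y A\<bar> \<le> 0"
        using 0 by (cases "A = {0..1} - A") auto
      then show "emeasure x A = emeasure y A"
        by (simp add: x.emeasure_eq_measure y.emeasure_eq_measure)
    qed
  next
    assume "x = y"
    then have "tv_dist x y \<le> 0" by (intro tv_dist_leI) simp_all
    moreover have "0 \<le> tv_dist x y" by (simp add: tv_dist_def)
    ultimately show "tv_dist x y = 0" by linarith
  qed
next
  fix x y z assume xyz: "x \<in> unit_measures" "y \<in> unit_measures" "z \<in> unit_measures"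
  show "tv_dist x z \<le> tv_dist x y + tv_dist y z"
  proof (rule tv_dist_leI)
    show "0 \<le> tv_dist x y + tv_dist y z" by (simp add: tv_dist_def)
    fix P assume P: "finite P" "disjoint P" "P \<subseteq> sets unit_borel" "\<Union>P = {0..1::real}"
    have "(\<Sum>A\<in>P. \<bar>measure x A - measure z A\<bar>) \<le>
        (\<Sum>A\<in>P. \<bar>measure x A - measure y A\<bar> + \<bar>measure y A - measure z A\<bar>)"
      by (intro sum_mono) auto
    also have "\<dots> \<le> tv_dist x y + tv_dist y z"
      using tv_sum_le[OF xyz(1,2) P] tv_sum_le[OF xyz(2,3) P] by (simp add: sum.distrib)
    finally show "(\<Sum>A\<in>P. \<bar>measure x A - measure z A\<bar>) \<le> tv_dist x y + tv_dist y z" .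
  qed
qed

section \<open>Interaction kernels\<close>

text \<open>The Borel structure on the finite measures is that of the total variation norm. Where an
  integral does not exist it is \<open>0\<close> by convention; for almost everywhere equal \<open>\<phi>\<close>, \<open>\<psi>\<close> this
  does not affect the condition below.\<close>

definition interaction_kernel :: "(real \<Rightarrow> real measure) \<Rightarrow> bool" where
  "interaction_kernel K \<longleftrightarrow>
     K \<in> measurable unit_borel (borel_of_topology tv_topology) \<and>
     (\<forall>\<phi>\<in>borel_measurable unit_borel. \<forall>\<psi>\<in>borel_measurable unit_borel.
        (AE v in unit_lborel. \<phi> v = (\<psi> v :: real)) \<longrightarrow>
        (AE u in unit_lborel. (LINT v|K u. \<phi> v) = (LINT v|K u. \<psi> v)))"

text \<open>Boundedness of \<open>\<phi> \<mapsto> (u \<mapsto> \<langle>K u, \<phi>\<rangle>)\<close> as an operator from \<open>L\<^sup>1\<close> to \<open>L\<^sup>1\<close>; linearity is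
  automatic.\<close>

definition bounded_on_L1 :: "(real \<Rightarrow> real measure) \<Rightarrow> bool" where
  "bounded_on_L1 K \<longleftrightarrow> (\<exists>C. \<forall>\<phi> :: real \<Rightarrow> real. integrable unit_lborel \<phi> \<longrightarrow>
     (AE u in unit_lborel. integrable (K u) \<phi>) \<and>
     integrable unit_lborel (\<lambda>u. LINT v|K u. \<phi> v) \<and>
     (LINT u|unit_lborel. \<bar>LINT v|K u. \<phi> v\<bar>) \<le> C * (LINT u|unit_lborel. \<bar>\<phi> u\<bar>))"

definition kernel_shift :: "(real \<Rightarrow> real measure) \<Rightarrow> real \<Rightarrow> real \<Rightarrow> real measure" where
  "kernel_shift K \<kappa> u = (if u + \<kappa> \<in> {0..1} then K (u + \<kappa>) else K u)"

definition translation_continuous :: "(real \<Rightarrow> real measure) \<Rightarrow> real \<Rightarrow> bool" where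
  "translation_continuous K \<alpha>\<^sub>0 \<longleftrightarrow>
     ((\<lambda>\<kappa>. \<integral>\<^sup>+u. ennreal (tv_dist (kernel_shift K \<kappa> u) (K u) powr \<alpha>\<^sub>0) \<partial>unit_lborel)
       \<longlongrightarrow> 0) (at 0)"

text \<open>Lebesgue version of (the class of) a locally integrable function on \<open>D\<close>: the value \<open>c\<close> at a
  Lebesgue point, and \<open>0\<close> elsewhere. It depends on \<open>f\<close> only up to null sets.\<close>

definition lebesgue_value :: "'a::euclidean_space set \<Rightarrow> ('a \<Rightarrow> real) \<Rightarrow> 'a \<Rightarrow> real \<Rightarrow> bool" where
  "lebesgue_value D f z c \<longleftrightarrow>
     ((\<lambda>r. (\<integral>\<^sup>+y\<in>ball z r \<inter> D. ennreal \<bar>f y - c\<bar> \<partial>lborel) / emeasure lborel (ball z r \<inter> D))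
       \<longlongrightarrow> 0) (at_right 0)"

definition lebesgue_version :: "'a::euclidean_space set \<Rightarrow> ('a \<Rightarrow> real) \<Rightarrow> 'a \<Rightarrow> real" where
  "lebesgue_version D f z =
     (if \<exists>c. lebesgue_value D f z c then THE c. lebesgue_value D f z c else 0)"

text \<open>\<open>interaction K q u x\<close> is \<open>\<langle>K u, q x\<rangle>\<close> in its Lebesgue version in \<open>(u, x)\<close>, where \<open>q x v\<close>
  is the density at \<open>x\<close> of the particle with label \<open>v\<close>.\<close>

definition interaction ::
    "(real \<Rightarrow> real measure) \<Rightarrow> (real^'d \<Rightarrow> real \<Rightarrow> real) \<Rightarrow> real \<Rightarrow> real^'d \<Rightarrow> real" where
  "interaction K q u x =
     lebesgue_version ({0..1} \<times> UNIV) (\<lambda>(u, x). LINT v|K u. q x v) (u, x)"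

section \<open>Test functions\<close>

primrec k_times_cont_diff ::
    "nat \<Rightarrow> ('a::real_normed_vector \<Rightarrow> 'b::real_normed_vector) \<Rightarrow> bool" where
  "k_times_cont_diff 0 f \<longleftrightarrow> continuous_on UNIV f"
| "k_times_cont_diff (Suc k) f \<longleftrightarrow>
     (\<exists>f'. (\<forall>x. (f has_derivative f' x) (at x)) \<and> (\<forall>v. k_times_cont_diff k (\<lambda>x. f' x v)))"

text \<open>\<open>C\<^sub>c\<^sup>\<infinity>([0,T) \<times> \<real>\<^sup>d \<times> (0,1))\<close>: its members are the restrictions to nonnegative times of the smooth
  functions with compact support in \<open>(-\<infinity>,T) \<times> \<real>\<^sup>d \<times> (0,1)\<close>, by which they are represented here. In
  particular a test function need not vanish at time \<open>0\<close>.\<close>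

definition test_function :: "real \<Rightarrow> (real \<times> (real^'d) \<times> real \<Rightarrow> real) \<Rightarrow> bool" where
  "test_function T \<phi> \<longleftrightarrow>
     (\<forall>k. k_times_cont_diff k \<phi>) \<and>
     compact (closure {z. \<phi> z \<noteq> 0}) \<and>
     closure {z. \<phi> z \<noteq> 0} \<subseteq> {..<T} \<times> UNIV \<times> {0<..<1}"

definition time_deriv ::
    "(real \<times> (real^'d) \<times> real \<Rightarrow> real) \<Rightarrow> real \<Rightarrow> real^'d \<Rightarrow> real \<Rightarrow> real" where
  "time_deriv \<phi> t x u = deriv (\<lambda>s. \<phi> (s, x, u)) t"

definition space_grad ::
    "(real \<times> (real^'d) \<times> real \<Rightarrow> real) \<Rightarrow> real \<Rightarrow> real^'d \<Rightarrow> real \<Rightarrow> real^'d" where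
  "space_grad \<phi> t x u = (\<chi> i. deriv (\<lambda>s. \<phi> (t, x + s *\<^sub>R axis i 1, u)) 0)"

definition space_laplacian ::
    "(real \<times> (real^'d) \<times> real \<Rightarrow> real) \<Rightarrow> real \<Rightarrow> real^'d \<Rightarrow> real \<Rightarrow> real" where
  "space_laplacian \<phi> t x u =
     (\<Sum>i\<in>UNIV. deriv (deriv (\<lambda>s. \<phi> (t, x + s *\<^sub>R axis i 1, u))) 0)"

section \<open>Solutions of the Fokker--Planck system\<close>

text \<open>\<open>p t x u\<close> stands for \<open>p\<^sup>u\<^sub>t(x)\<close>. It is only relevant for \<open>t \<in> (0,T]\<close>, so integrals over time
  run over \<open>(0,T]\<close>.\<close>

definition fp_curve ::
    "(real \<Rightarrow> (real^'d) measure) \<Rightarrow> (real \<Rightarrow> real^'d \<Rightarrow> real \<Rightarrow> real) \<Rightarrow> real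
      \<Rightarrow> ((real^'d) \<times> real) measure" where
  "fp_curve \<nu> p t =
     (if t = 0
      then unit_lborel \<bind> (\<lambda>u. distr (\<nu> u) (restrict_space borel (UNIV \<times> {0..1})) (\<lambda>x. (x, u)))
      else density (restrict_space lborel (UNIV \<times> {0..1})) (\<lambda>(x, u). ennreal (p t x u)))"

abbreviation fp_domain :: "real \<Rightarrow> (real \<times> (real^'d) \<times> real) measure" where
  "fp_domain T \<equiv> restrict_space lborel ({0<..T} \<times> UNIV \<times> {0..1})"

definition fp_solution ::
    "real \<Rightarrow> (real \<Rightarrow> real^'d \<Rightarrow> real \<Rightarrow> real^'d) \<Rightarrow> (real \<Rightarrow> real measure)
      \<Rightarrow> (real \<Rightarrow> (real^'d) measure) \<Rightarrow> (real \<Rightarrow> real^'d \<Rightarrow> real \<Rightarrow> real) \<Rightarrow> bool" where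
  "fp_solution T b K \<nu> p \<longleftrightarrow>
     (\<forall>t\<in>{0<..T}. \<forall>u\<in>{0..1}. (\<lambda>x. p t x u) \<in> borel_measurable borel \<and>
        (\<forall>x. 0 \<le> p t x u) \<and> (\<integral>\<^sup>+x. ennreal (p t x u) \<partial>lborel) = 1) \<and>
     \<nu> \<in> measurable unit_borel (borel_of_topology (weak_topology UNIV)) \<and>
     (\<forall>R. set_integrable lborel ({0<..T} \<times> cball 0 R \<times> {0..1}) (\<lambda>(t, x, u). p t x u)) \<and>
     continuous_map (top_of_set {0..T}) (weak_topology (UNIV \<times> {0..1})) (fp_curve \<nu> p) \<and>
     (AE (t, x, u) in density (fp_domain T) (\<lambda>(t, x, u). ennreal (p t x u)).
        (\<integral>\<^sup>+v. ennreal (p t x v) \<partial>K u) < \<infinity>) \<and>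
     (\<integral>\<^sup>+(t, x, u). ennreal ((norm (b t x (interaction K (p t) u x)) + 1) * p t x u)
        \<partial>fp_domain T) < \<infinity> \<and>
     (\<forall>\<phi>. test_function T \<phi> \<longrightarrow>
        (LINT (t, x, u)|fp_domain T.
           (time_deriv \<phi> t x u + b t x (interaction K (p t) u x) \<bullet> space_grad \<phi> t x u
             + space_laplacian \<phi> t x u) * p t x u)
        + (LINT u|unit_lborel. LINT x|\<nu> u. \<phi> (0, x, u)) = 0)"

section \<open>Euler scheme\<close>

definition usual_filtered_space :: "'\<omega> measure \<Rightarrow> (real \<Rightarrow> '\<omega> measure) \<Rightarrow> bool" where
  "usual_filtered_space M F \<longleftrightarrow>
     prob_space M \<and> complete_measure M \<and>
     (\<forall>t\<ge>0. subalgebra M (F t)) \<and>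
     (\<forall>s\<ge>0. \<forall>t\<ge>s. sets (F s) \<subseteq> sets (F t)) \<and>
     (\<forall>t\<ge>0. sets (F t) = (\<Inter>s\<in>{t<..}. sets (F s))) \<and>
     null_sets M \<subseteq> sets (F 0)"

definition wiener_process ::
    "'\<omega> measure \<Rightarrow> (real \<Rightarrow> '\<omega> measure) \<Rightarrow> (real \<Rightarrow> '\<omega> \<Rightarrow> real^'d) \<Rightarrow> bool" where
  "wiener_process M F W \<longleftrightarrow>
     (\<forall>t\<ge>0. W t \<in> borel_measurable (F t)) \<and>
     (AE \<omega> in M. W 0 \<omega> = 0) \<and>
     (AE \<omega> in M. continuous_on {0..} (\<lambda>t. W t \<omega>)) \<and>
     (\<forall>s\<ge>0. \<forall>t>s.
        distr M borel (\<lambda>\<omega>. W t \<omega> - W s \<omega>) =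
          density lborel (\<lambda>x. ennreal (\<Prod>i\<in>UNIV. normal_density 0 (sqrt (t - s)) (x $ i))) \<and>
        prob_space.indep_set M (sets (F s))
          (sets (vimage_algebra (space M) (\<lambda>\<omega>. W t \<omega> - W s \<omega>) borel)))"

text \<open>\<open>X t u\<close> is the Euler approximation at time \<open>t\<close> with step size \<open>T / N\<close> and label \<open>u\<close>, and
  \<open>q t x u\<close> is the continuous version of the density of its law. Since the law of \<open>X t u\<close>,
  \<open>t > 0\<close>, is the convolution of a probability measure with a Gaussian, such a density exists and
  is unique, so that \<open>X\<close> and \<open>q\<close> are determined on \<open>[0,T] \<times> [0,1]\<close> and \<open>(0,T] \<times> \<real>\<^sup>d \<times> [0,1]\<close>.\<close>

definition euler_scheme ::
    "'\<omega> measure \<Rightarrow> (real \<Rightarrow> '\<omega> \<Rightarrow> real^'d) \<Rightarrow> (real \<Rightarrow> '\<omega> \<Rightarrow> real^'d) \<Rightarrow> real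
      \<Rightarrow> (real \<Rightarrow> real^'d \<Rightarrow> real \<Rightarrow> real^'d) \<Rightarrow> (real \<Rightarrow> real measure) \<Rightarrow> nat
      \<Rightarrow> (real \<Rightarrow> real \<Rightarrow> '\<omega> \<Rightarrow> real^'d) \<Rightarrow> (real \<Rightarrow> real^'d \<Rightarrow> real \<Rightarrow> real) \<Rightarrow> bool" where
  "euler_scheme M W X\<^sub>0 T b K N X q \<longleftrightarrow> (let h = T / real N in
     (\<forall>u\<in>{0..1}. \<forall>\<omega>\<in>space M.
        (\<forall>t\<in>{0..h}. X t u \<omega> = X\<^sub>0 u \<omega> + sqrt 2 *\<^sub>R W t \<omega>) \<and>
        (\<forall>k\<in>{1..<N}. \<forall>t\<in>{real k * h..real (k + 1) * h}.
           X t u \<omega> = X (real k * h) u \<omega>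
             + (LINT s:{real k * h..t}|lborel.
                  b s (X (real k * h) u \<omega>)
                    (interaction K (q (real k * h)) u (X (real k * h) u \<omega>)))
             + sqrt 2 *\<^sub>R (W t \<omega> - W (real k * h) \<omega>))) \<and>
     (\<forall>t\<in>{0<..T}. \<forall>u\<in>{0..1}.
        continuous_on UNIV (\<lambda>x. q t x u) \<and> (\<forall>x. 0 \<le> q t x u) \<and>
        distr M borel (X t u) = density lborel (\<lambda>x. ennreal (q t x u))))"

text \<open>Continuity of a map \<open>S \<rightarrow> L\<^sup>1(\<mu>)\<close>, given by representatives.\<close>

definition L1_continuous_on ::
    "'a::topological_space set \<Rightarrow> 'b measure \<Rightarrow> ('a \<Rightarrow> 'b \<Rightarrow> real) \<Rightarrow> bool" where
  "L1_continuous_on S \<mu> f \<longleftrightarrow>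
     (\<forall>z\<in>S. integrable \<mu> (f z)) \<and>
     (\<forall>z\<in>S. ((\<lambda>z'. LINT u|\<mu>. \<bar>f z' u - f z u\<bar>) \<longlongrightarrow> 0) (at z within S))"

definition locally_uniform_euler_limit ::
    "real \<Rightarrow> (nat \<Rightarrow> real \<Rightarrow> real^'d \<Rightarrow> real \<Rightarrow> real) \<Rightarrow> (real \<Rightarrow> real^'d \<Rightarrow> real \<Rightarrow> real) \<Rightarrow> bool"
  where
  "locally_uniform_euler_limit T q p \<longleftrightarrow>
     (\<exists>r :: nat \<Rightarrow> nat. strict_mono r \<and> (\<forall>k. 1 \<le> r k) \<and>
        (\<forall>m::nat. real m > 1 / T \<longrightarrow>
           (\<lambda>k. SUP y\<in>cball 0 (real m). SUP t\<in>{1 / real m..T}.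
              \<integral>\<^sup>+u. ennreal \<bar>q (r k) t y u - p t y u\<bar> \<partial>unit_lborel) \<longlonglongrightarrow> 0))"

end

theory Submission
  imports Defs
begin

text \<open>
  Between two grid points the Euler scheme moves the position by a drift that, up to the choice of
  a representative, depends on the label \<open>u\<close> only through \<open>K u\<close>, and by a Wiener increment
  that does not depend on \<open>u\<close> at all. Labels of one block \<open>A j\<close> should therefore carry the same law
  at every time. The difficulty is that the interaction \<open>\<langle>K u, q x\<rangle>\<close> enters in its Lebesgue
  version in the pair \<open>(u, x)\<close>: its value at \<open>(u, x)\<close> is determined by averages over neighbouring
  labels, which may lie in other blocks, so two labels of one block may well see different drifts.

  Lebesgue differentiation resolves this. Boundedness of the kernel on \<open>L\<^sup>1\<close> makes
  \<open>(u, x) \<mapsto> \<langle>K u, q x\<rangle>\<close> integrable, so for almost every label \<open>u\<close> the Lebesgue version agrees with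
  \<open>\<langle>K u, q x\<rangle>\<close> for almost every \<open>x\<close> (\<open>AE_interaction_eq\<close>), and the latter is the same function of
  \<open>x\<close> for all labels of a block. Positions at positive grid points have a density, hence they avoid
  the exceptional \<open>x\<close> almost surely. So the drifts of two labels of a block, outside a null set of
  labels, agree almost surely as functions of the position, and equality of laws is passed from one
  grid point to the next (\<open>block_law_process_euler_step\<close>, \<open>euler_scheme_block_law\<close>).

  The induction also carries joint measurability in label and randomness, without which neither the
  integrals against \<open>K u\<close> nor the differentiation theorem could be used. It survives a step because
  the Lebesgue version of a Borel function is Borel (\<open>borel_measurable_lebesgue_version\<close>) and because
  \<open>K\<close> takes only countably many values (\<open>borel_measurable_kernel_integral\<close>).

  Continuous densities are determined by the law, so \<open>u \<mapsto> q N t y u\<close> is almost everywhere constant on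
  each block, and this property is closed under convergence in \<open>L\<^sup>1\<close> (\<open>AE_constant_L1_limit\<close>).
\<close>

section \<open>Lebesgue differentiation over balls\<close>

lemma emeasure_ball_Int_finite:
  "emeasure lborel (ball (z::'a::euclidean_space) r \<inter> D) < \<infinity>"
proof -
  have "emeasure lborel (ball z r \<inter> D) \<le> emeasure lborel (ball z r)"
    by (intro emeasure_mono) auto
  then show ?thesis using emeasure_lborel_ball_finite[of z r] by (simp add: le_less_trans)
qed

lemma emeasure_cball_Int_eq_ball_Int:
  fixes z :: "'a::euclidean_space"
  assumes [measurable]: "D \<in> sets borel"
  shows "emeasure lborel (cball z r \<inter> D) = emeasure lborel (ball z r \<inter> D)"
proof (rule emeasure_eq_AE)
  have "sphere z r \<in> null_sets lborel"
    using negligible_sphere[of z r] negligible_iff_null_sets null_sets_completion_iff[of "sphere z r" lborel]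
    by auto
  then have "AE x in lborel. x \<notin> sphere z r" by (rule AE_not_in)
  then show "AE x in lborel. (x \<in> cball z r \<inter> D) = (x \<in> ball z r \<inter> D)"
    by eventually_elim auto
qed auto

text \<open>The condition is lower semicontinuous in \<open>z\<close>: if it holds for some
  radius, it survives a small move of the centre, as the moved ball contains a slightly smaller
  ball around \<open>z\<close> and is contained in a slightly larger one. This openness is the
  only source of measurability for ball means below.\<close>

lemma open_ball_mean_gt:
  fixes h :: "'a::euclidean_space \<Rightarrow> ennreal"
  assumes h[measurable]: "h \<in> borel_measurable borel" and D[measurable]: "D \<in> sets borel"
    and e: "e < \<top>"
  shows "open {z. \<exists>r\<in>{0<..<\<delta>}. e * emeasure lborel (ball z r \<inter> D) < (\<integral>\<^sup>+y\<in>ball z r \<inter> D. h y \<partial>lborel)}"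
    (is "open ?G")
  unfolding open_contains_ball
proof
  fix z assume "z \<in> ?G"
  define \<mu> where "\<mu> = density lborel h"
  have \<mu>: "(\<integral>\<^sup>+y\<in>B. h y \<partial>lborel) = emeasure \<mu> B" if "B \<in> sets borel" for B
    using that by (simp add: \<mu>_def emeasure_density)
  from \<open>z \<in> ?G\<close> obtain r where r: "0 < r" "r < \<delta>"
    and gt: "e * emeasure lborel (ball z r \<inter> D) < emeasure \<mu> (ball z r \<inter> D)"
    using \<mu>[of "ball _ _ \<inter> D"] by auto
  define s where "s n = 1 / (real n + 1)" for n
  have s: "s \<longlonglongrightarrow> 0" unfolding s_def by real_asymp
  have s_mono: "s n \<le> s m" if "m \<le> n" for m n unfolding s_def using that by (intro divide_left_mono) auto
  have s_pos: "0 < s n" for n by (simp add: s_def)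
  have "(\<lambda>n. emeasure \<mu> (ball z (r - s n) \<inter> D)) \<longlonglongrightarrow> emeasure \<mu> (\<Union>n. ball z (r - s n) \<inter> D)"
  proof (intro Lim_emeasure_incseq)
    show "range (\<lambda>n. ball z (r - s n) \<inter> D) \<subseteq> sets \<mu>" by (auto simp: \<mu>_def)
    show "incseq (\<lambda>n. ball z (r - s n) \<inter> D)"
      using s_mono by (fastforce simp: incseq_def)
  qed
  also have "(\<Union>n. ball z (r - s n) \<inter> D) = ball z r \<inter> D"
  proof -
    have "\<exists>n. dist z x < r - s n" if "dist z x < r" for x
    proof -
      have "\<forall>\<^sub>F n in sequentially. s n < r - dist z x"
        using that by (intro order_tendstoD(2)[OF s]) simp
      then obtain n where "s n < r - dist z x" by (auto dest: eventually_happens)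
      then show ?thesis by (intro exI[of _ n]) simp
    qed
    moreover have "dist z x < r" if "dist z x < r - s n" for x n using that s_pos[of n] by linarith
    ultimately show ?thesis by fastforce
  qed
  finally have lim1: "(\<lambda>n. emeasure \<mu> (ball z (r - s n) \<inter> D)) \<longlonglongrightarrow> emeasure \<mu> (ball z r \<inter> D)" .
  have "(\<lambda>n. emeasure lborel (ball z (r + s n) \<inter> D)) \<longlonglongrightarrow> emeasure lborel (\<Inter>n. ball z (r + s n) \<inter> D)"
  proof (intro Lim_emeasure_decseq)
    show "decseq (\<lambda>n. ball z (r + s n) \<inter> D)"
      using s_mono by (fastforce simp: decseq_def)
  qed (use emeasure_ball_Int_finite[of z _ D] in \<open>auto simp: less_top\<close>)
  also have "(\<Inter>n. ball z (r + s n) \<inter> D) = cball z r \<inter> D"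
  proof -
    have "dist z x \<le> r" if "\<forall>n. dist z x < r + s n" for x
      using that by (intro LIMSEQ_le_const[OF tendsto_add[OF tendsto_const s], of _ r, simplified])
        (auto intro: less_imp_le)
    moreover have "dist z x < r + s n" if "dist z x \<le> r" for x n using that s_pos[of n] by linarith
    ultimately show ?thesis by fastforce
  qed
  finally have "(\<lambda>n. e * emeasure lborel (ball z (r + s n) \<inter> D)) \<longlonglongrightarrow> e * emeasure lborel (ball z r \<inter> D)"
    unfolding emeasure_cball_Int_eq_ball_Int[OF D] using e by (intro ennreal_tendsto_cmult) auto
  \<comment> \<open>Strict inequality between the limits leaves room to shrink the ball on the right and to enlarge
    the one on the left at the same time.\<close>
  moreover obtain c where c: "e * emeasure lborel (ball z r \<inter> D) < c" "c < emeasure \<mu> (ball z r \<inter> D)"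
    using dense[OF gt] by auto
  ultimately have "\<forall>\<^sub>F n in sequentially. e * emeasure lborel (ball z (r + s n) \<inter> D) < c"
    by (auto dest: order_tendstoD)
  moreover have "\<forall>\<^sub>F n in sequentially. c < emeasure \<mu> (ball z (r - s n) \<inter> D)"
    using lim1 c by (auto dest: order_tendstoD)
  ultimately have "\<forall>\<^sub>F n in sequentially. e * emeasure lborel (ball z (r + s n) \<inter> D) <
       emeasure \<mu> (ball z (r - s n) \<inter> D)"
    by eventually_elim auto
  then obtain n where n: "e * emeasure lborel (ball z (r + s n) \<inter> D) < emeasure \<mu> (ball z (r - s n) \<inter> D)"
    by (auto dest!: eventually_happens)
  have "z' \<in> ?G" if z': "dist z z' < s n" for z'
  proof -
    have "ball z' r \<subseteq> ball z (r + s n)"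
    proof
      fix x assume "x \<in> ball z' r" then show "x \<in> ball z (r + s n)"
        using z' dist_triangle[of z x z'] by auto
    qed
    then have "e * emeasure lborel (ball z' r \<inter> D) \<le> e * emeasure lborel (ball z (r + s n) \<inter> D)"
      by (intro mult_left_mono emeasure_mono) auto
    also note n
    also have "ball z (r - s n) \<subseteq> ball z' r"
    proof
      fix x assume "x \<in> ball z (r - s n)" then show "x \<in> ball z' r"
        using z' dist_triangle[of z' x z] by (auto simp: dist_commute)
    qed
    then have "emeasure \<mu> (ball z (r - s n) \<inter> D) \<le> emeasure \<mu> (ball z' r \<inter> D)"
      by (intro emeasure_mono) (auto simp: \<mu>_def)
    finally show ?thesis using r \<mu>[of "ball z' r \<inter> D"] by (intro CollectI bexI[of _ r]) simp_all
  qed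
  then show "\<exists>\<epsilon>>0. ball z \<epsilon> \<subseteq> ?G"
    using s_pos[of n] by (intro exI[of _ "s n"]) auto
qed

text \<open>Lebesgue differentiation for a nonnegative integrable function. Let \<open>E\<close>
  be the set where \<open>h < a\<close> although arbitrarily small balls have mean greater than
  \<open>a\<close>. Vitali coverings of \<open>E\<close> by such balls inside an open
  \<open>U\<close> give \<open>a * |E| \<le> \<integral>\<^sub>U h\<close>, and outer regularity
  of the measure with density \<open>h\<close> improves this to \<open>a * |E| \<le>
  \<integral>\<^sub>E h\<close>; as \<open>h < a\<close> on \<open>E\<close>, the set
  \<open>E\<close> is null.\<close>

lemma AE_eventually_ball_mean_le:
  fixes h :: "'a::euclidean_space \<Rightarrow> ennreal"
  assumes h[measurable]: "h \<in> borel_measurable borel" and fin: "(\<integral>\<^sup>+y. h y \<partial>lborel) < \<infinity>"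
    and a: "0 < a"
  shows "AE z in lborel. h z < ennreal a \<longrightarrow>
    (\<forall>\<^sub>F r in at_right 0. (\<integral>\<^sup>+y\<in>ball z r. h y \<partial>lborel) \<le> ennreal a * emeasure lborel (ball z r))"
proof -
  define \<mu> where "\<mu> = density lborel h"
  have sets_\<mu>[measurable_cong, simp]: "sets \<mu> = sets borel" by (simp add: \<mu>_def)
  have \<mu>: "(\<integral>\<^sup>+y\<in>B. h y \<partial>lborel) = emeasure \<mu> B" if "B \<in> sets borel" for B
    using that by (simp add: \<mu>_def emeasure_density)
  define G where "G n = {z. \<exists>r\<in>{0<..<1 / (real n + 1)}. ennreal a * emeasure lborel (ball z r) < emeasure \<mu> (ball z r)}"
    for n
  have "open (G n)" for n
    using open_ball_mean_gt[OF h, of UNIV "ennreal a" "1 / (real n + 1)"] \<mu> by (simp add: G_def)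
  then have [measurable]: "G n \<in> sets borel" for n by simp
  define E where "E = {z \<in> space borel. h z < ennreal a} \<inter> (\<Inter>n. G n)"
  have E[measurable]: "E \<in> sets borel" unfolding E_def by measurable
  have bound: "ennreal a * emeasure lborel E \<le> emeasure \<mu> U" if U: "open U" "E \<subseteq> U" for U
  proof -
    define I where "I = {(z, r). 0 < r \<and> ball z r \<subseteq> U \<and> ennreal a * emeasure lborel (ball z r) < emeasure \<mu> (ball z r)}"
    have I: "\<exists>i. i \<in> I \<and> x \<in> ball (fst i) (snd i) \<and> snd i < d" if "x \<in> E" "0 < d" for x d
    proof -
      obtain \<epsilon> where \<epsilon>: "0 < \<epsilon>" "ball x \<epsilon> \<subseteq> U" using U \<open>x \<in> E\<close> by (meson openE subsetD)
      obtain n where n: "1 / (real n + 1) < min d \<epsilon>"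
        using reals_Archimedean[of "min d \<epsilon>"] \<epsilon> \<open>0 < d\<close> by (auto simp: inverse_eq_divide add.commute)
      from \<open>x \<in> E\<close> have "x \<in> G n" by (auto simp: E_def)
      then obtain r where r: "0 < r" "r < 1 / (real n + 1)" "ennreal a * emeasure lborel (ball x r) < emeasure \<mu> (ball x r)"
        by (auto simp: G_def)
      have "ball x r \<subseteq> ball x \<epsilon>" using r n by (intro subset_ball) auto
      then show ?thesis using r n \<epsilon> by (intro exI[of _ "(x, r)"]) (auto simp: I_def)
    qed
    obtain C where C: "countable C" "C \<subseteq> I"
      "pairwise (\<lambda>i j. disjnt (ball (fst i) (snd i)) (ball (fst j) (snd j))) C"
      "negligible (E - (\<Union>i\<in>C. ball (fst i) (snd i)))"
      using Vitali_covering_theorem_balls[of E I fst snd, OF I] by blast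
    define V where "V = (\<Union>i\<in>C. ball (fst i) (snd i))"
    have V[measurable]: "V \<in> sets borel" unfolding V_def using C(1) by (intro sets.countable_UN') auto
    have disj: "disjoint_family_on (\<lambda>i. ball (fst i) (snd i)) C"
      using C(3) by (auto simp: disjoint_family_on_def pairwise_def disjnt_def)
    have "E - V \<in> null_sets lborel"
      using C(4) null_sets_completion_iff[of "E - V" lborel] by (simp add: negligible_iff_null_sets flip: V_def)
    then have "AE x in lborel. x \<notin> E - V" by (rule AE_not_in)
    then have "emeasure lborel E \<le> emeasure lborel V"
      by (intro emeasure_mono_AE) auto
    then have "ennreal a * emeasure lborel E \<le> ennreal a * emeasure lborel V"
      by (intro mult_left_mono) auto
    also have "emeasure lborel V = (\<integral>\<^sup>+i. emeasure lborel (ball (fst i) (snd i)) \<partial>count_space C)"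
      unfolding V_def using C disj by (intro emeasure_UN_countable) auto
    also have "ennreal a * \<dots> = (\<integral>\<^sup>+i. ennreal a * emeasure lborel (ball (fst i) (snd i)) \<partial>count_space C)"
      by (simp add: nn_integral_cmult)
    also have "\<dots> \<le> (\<integral>\<^sup>+i. emeasure \<mu> (ball (fst i) (snd i)) \<partial>count_space C)"
      using C(2) by (intro nn_integral_mono) (auto simp: I_def intro: less_imp_le)
    also have "\<dots> = emeasure \<mu> V"
      unfolding V_def using C disj by (intro emeasure_UN_countable[symmetric]) auto
    also have "\<dots> \<le> emeasure \<mu> U"
    proof (intro emeasure_mono)
      show "V \<subseteq> U" 
      proof
        fix x assume "x \<in> V"
        then obtain i where "i \<in> C" "x \<in> ball (fst i) (snd i)" unfolding V_def by blast
        moreover have "i \<in> I" using C(2) \<open>i \<in> C\<close> by blast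
        ultimately show "x \<in> U" unfolding I_def by (cases i) auto
      qed
    qed (use U in simp)
    finally show ?thesis .
  qed
  have "emeasure \<mu> (space \<mu>) \<noteq> \<infinity>" using fin \<mu>[of UNIV] by (auto simp: \<mu>_def)
  then have "emeasure \<mu> E = (INF U\<in>{U. E \<subseteq> U \<and> open U}. emeasure \<mu> U)"
    using E by (intro outer_regular) auto
  then have le: "ennreal a * emeasure lborel E \<le> emeasure \<mu> E"
    using bound by (auto intro!: INF_greatest)
  have "AE z in lborel. ennreal a * indicator E z \<le> h z * indicator E z"
  proof (rule ccontr)
    assume "\<not> ?thesis"
    moreover have "(\<integral>\<^sup>+z. h z * indicator E z \<partial>lborel) \<le> (\<integral>\<^sup>+z. h z \<partial>lborel)"
      by (intro nn_integral_mono) (auto split: split_indicator)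
    ultimately have "(\<integral>\<^sup>+z. h z * indicator E z \<partial>lborel) < (\<integral>\<^sup>+z. ennreal a * indicator E z \<partial>lborel)"
      using fin by (intro nn_integral_less) (auto simp: E_def split: split_indicator)
    then have "emeasure \<mu> E < ennreal a * emeasure lborel E"
      using \<mu>[OF E] by (simp add: nn_integral_cmult)
    with le show False by simp
  qed
  then show ?thesis
  proof eventually_elim
    case (elim z)
    show ?case
    proof
      assume z: "h z < ennreal a"
      then have "z \<notin> E" using elim by auto
      then obtain n where n: "z \<notin> G n" using z by (auto simp: E_def)
      show "\<forall>\<^sub>F r in at_right 0. (\<integral>\<^sup>+y\<in>ball z r. h y \<partial>lborel) \<le> ennreal a * emeasure lborel (ball z r)"
        using n \<mu>[of "ball z _"]
        by (intro eventually_at_rightI[of _ "1 / (real n + 1)"]) (auto simp: G_def not_less)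
    qed
  qed
qed

section \<open>The Lebesgue version of a Borel function\<close>

text \<open>The quantitative form of a Lebesgue value. With \<open>c\<close> and
  \<open>e\<close> restricted to the rationals it turns statements about limits over all real
  radii into countable combinations of Borel conditions.\<close>

definition eventual_mean_deviation_le ::
    "'a::euclidean_space set \<Rightarrow> ('a \<Rightarrow> real) \<Rightarrow> 'a \<Rightarrow> real \<Rightarrow> real \<Rightarrow> bool" where
  "eventual_mean_deviation_le D f z c e \<longleftrightarrow>
     (\<forall>\<^sub>F r in at_right 0. (\<integral>\<^sup>+y\<in>ball z r \<inter> D. ennreal \<bar>f y - c\<bar> \<partial>lborel)
        \<le> ennreal e * emeasure lborel (ball z r \<inter> D))"

text \<open>Where this fails, the averages in the definition of a Lebesgue value are quotients
  \<open>0 / 0\<close> and every number is a Lebesgue value.\<close>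

definition locally_nonnull_at :: "'a::euclidean_space set \<Rightarrow> 'a \<Rightarrow> bool" where
  "locally_nonnull_at D z \<longleftrightarrow> (\<forall>r>0. emeasure lborel (ball z r \<inter> D) \<noteq> 0)"

lemma lebesgue_value_iff:
  assumes "locally_nonnull_at D z"
  shows "lebesgue_value D f z c \<longleftrightarrow> (\<forall>e>0. eventual_mean_deviation_le D f z c e)"
proof -
  let ?N = "\<lambda>r. \<integral>\<^sup>+y\<in>ball z r \<inter> D. ennreal \<bar>f y - c\<bar> \<partial>lborel"
  let ?m = "\<lambda>r. emeasure lborel (ball z r \<inter> D)"
  have m: "?m r \<noteq> 0" "?m r < \<top>" if "0 < r" for r
    using assms that emeasure_ball_Int_finite[of z r D] by (auto simp: locally_nonnull_at_def)
  have pos: "\<forall>\<^sub>F r in at_right (0::real). 0 < r" by (simp add: eventually_at_right_less)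
  show ?thesis
  proof
    assume L: "lebesgue_value D f z c"
    show "\<forall>e>0. eventual_mean_deviation_le D f z c e"
    proof (intro allI impI)
      fix e :: real assume "0 < e"
      then have "\<forall>\<^sub>F r in at_right 0. ?N r / ?m r < ennreal e"
        using L by (intro order_tendstoD) (auto simp: lebesgue_value_def)
      with pos show "eventual_mean_deviation_le D f z c e"
        unfolding eventual_mean_deviation_le_def
      proof eventually_elim
        case (elim r)
        then show ?case using divide_less_ennreal[OF m[OF elim(1)]] by (simp add: less_imp_le)
      qed
    qed
  next
    assume A: "\<forall>e>0. eventual_mean_deviation_le D f z c e"
    show "lebesgue_value D f z c"
      unfolding lebesgue_value_def
    proof (rule order_tendstoI)
      fix a :: ennreal assume "0 < a"
      then obtain b where b: "0 < b" "b < a" using dense by blast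
      define e where "e = enn2real b"
      have e: "ennreal e < a" "0 < e" using b by (auto simp: e_def enn2real_positive_iff less_top[symmetric] ennreal_enn2real_if)
      have "eventual_mean_deviation_le D f z c e" using A e by auto
      with pos show "\<forall>\<^sub>F r in at_right 0. ?N r / ?m r < a"
        unfolding eventual_mean_deviation_le_def
      proof eventually_elim
        case (elim r)
        have "ennreal e * ?m r < a * ?m r"
          using m[OF \<open>0 < r\<close>] e by (intro ennreal_mult_strict_right_mono) (auto simp: zero_less_iff_neq_zero)
        with elim have "?N r < a * ?m r" by auto
        then show ?case using divide_less_ennreal[OF m[OF \<open>0 < r\<close>]] by simp
      qed
    qed auto
  qed
qed

lemma eventual_mean_deviation_le_shift:
  assumes f[measurable]: "f \<in> borel_measurable borel" and D[measurable]: "D \<in> sets borel" and "0 \<le> e"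
    and E: "eventual_mean_deviation_le D f z c e"
  shows "eventual_mean_deviation_le D f z c' (e + \<bar>c - c'\<bar>)"
  using E unfolding eventual_mean_deviation_le_def
proof eventually_elim
  case (elim r)
  have [measurable]: "ball z r \<inter> D \<in> sets borel" by simp
  have "(\<integral>\<^sup>+y\<in>ball z r \<inter> D. ennreal \<bar>f y - c'\<bar> \<partial>lborel)
      \<le> (\<integral>\<^sup>+y. ennreal \<bar>f y - c\<bar> * indicator (ball z r \<inter> D) y
            + ennreal \<bar>c - c'\<bar> * indicator (ball z r \<inter> D) y \<partial>lborel)"
    by (intro nn_integral_mono) (auto split: split_indicator simp flip: ennreal_plus intro!: ennreal_leI)
  also have "\<dots> = (\<integral>\<^sup>+y\<in>ball z r \<inter> D. ennreal \<bar>f y - c\<bar> \<partial>lborel)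
      + ennreal \<bar>c - c'\<bar> * emeasure lborel (ball z r \<inter> D)"
    by (subst nn_integral_add) (auto simp: nn_integral_cmult)
  also have "\<dots> \<le> ennreal e * emeasure lborel (ball z r \<inter> D) + ennreal \<bar>c - c'\<bar> * emeasure lborel (ball z r \<inter> D)"
    using elim by (intro add_mono) auto
  also have "\<dots> = ennreal (e + \<bar>c - c'\<bar>) * emeasure lborel (ball z r \<inter> D)"
    using \<open>0 \<le> e\<close> by (simp add: distrib_right)
  finally show ?case .
qed

text \<open>The mean of the constant \<open>|c - c'|\<close> over a small ball is at most the
  sum of the two mean deviations. This gives uniqueness of Lebesgue values, and the Cauchy
  property of approximate ones.\<close>

lemma eventual_mean_deviation_le_dist:
  assumes f[measurable]: "f \<in> borel_measurable borel" and D[measurable]: "D \<in> sets borel" and "0 \<le> e" "0 \<le> e'"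
    and E: "eventual_mean_deviation_le D f z c e" "eventual_mean_deviation_le D f z c' e'"
    and fat: "locally_nonnull_at D z"
  shows "\<bar>c - c'\<bar> \<le> e + e'"
proof -
  have pos: "\<forall>\<^sub>F r in at_right (0::real). 0 < r" by (simp add: eventually_at_right_less)
  have "\<forall>\<^sub>F r in at_right (0::real). \<bar>c - c'\<bar> \<le> e + e'"
    using E pos unfolding eventual_mean_deviation_le_def
  proof eventually_elim
    case (elim r)
    let ?m = "emeasure lborel (ball z r \<inter> D)"
    have [measurable]: "ball z r \<inter> D \<in> sets borel" by simp
    have m: "?m \<noteq> 0" "?m < \<top>"
      using fat elim emeasure_ball_Int_finite[of z r D] by (auto simp: locally_nonnull_at_def)
    have "ennreal \<bar>c - c'\<bar> * ?m = (\<integral>\<^sup>+y. ennreal \<bar>c - c'\<bar> * indicator (ball z r \<inter> D) y \<partial>lborel)"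
      by (simp add: nn_integral_cmult)
    also have "\<dots> \<le> (\<integral>\<^sup>+y. ennreal \<bar>f y - c\<bar> * indicator (ball z r \<inter> D) y
            + ennreal \<bar>f y - c'\<bar> * indicator (ball z r \<inter> D) y \<partial>lborel)"
      by (intro nn_integral_mono) (auto split: split_indicator simp flip: ennreal_plus intro!: ennreal_leI)
    also have "\<dots> = (\<integral>\<^sup>+y\<in>ball z r \<inter> D. ennreal \<bar>f y - c\<bar> \<partial>lborel)
        + (\<integral>\<^sup>+y\<in>ball z r \<inter> D. ennreal \<bar>f y - c'\<bar> \<partial>lborel)"
      by (subst nn_integral_add) auto
    also have "\<dots> \<le> ennreal e * ?m + ennreal e' * ?m" using elim by (intro add_mono) auto
    also have "\<dots> = ennreal (e + e') * ?m" using \<open>0 \<le> e\<close> \<open>0 \<le> e'\<close> by (simp add: distrib_right)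
    finally have "\<not> ennreal (e + e') * ?m < ennreal \<bar>c - c'\<bar> * ?m" by simp
    moreover have "ennreal (e + e') * ?m < ennreal \<bar>c - c'\<bar> * ?m" if "e + e' < \<bar>c - c'\<bar>"
      using that m \<open>0 \<le> e\<close> \<open>0 \<le> e'\<close>
      by (intro ennreal_mult_strict_right_mono) (auto simp: zero_less_iff_neq_zero ennreal_lessI simp del: ennreal_plus)
    ultimately show ?case by linarith
  qed
  then show ?thesis by simp
qed

text \<open>The complement is a countable intersection of the open sets of
  \<open>open_ball_mean_gt\<close>.\<close>

lemma eventual_mean_deviation_le_sets:
  assumes f[measurable]: "f \<in> borel_measurable borel" and D: "D \<in> sets borel"
  shows "{z. eventual_mean_deviation_le D f z c e} \<in> sets borel"
proof -
  define G where "G \<delta> = {z. \<exists>r\<in>{0<..<\<delta>}. ennreal e * emeasure lborel (ball z r \<inter> D)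
    < (\<integral>\<^sup>+y\<in>ball z r \<inter> D. ennreal \<bar>f y - c\<bar> \<partial>lborel)}" for \<delta>
  have "open (G \<delta>)" for \<delta> unfolding G_def by (intro open_ball_mean_gt D) auto
  then have [measurable]: "G \<delta> \<in> sets borel" for \<delta> by simp
  have "{z. eventual_mean_deviation_le D f z c e} = (\<Union>n. - G (1 / (real n + 1)))"
  proof (intro set_eqI iffI)
    fix z assume "z \<in> {z. eventual_mean_deviation_le D f z c e}"
    then obtain \<delta> where \<delta>: "0 < \<delta>" "\<And>r. 0 < r \<Longrightarrow> r < \<delta> \<Longrightarrow>
        (\<integral>\<^sup>+y\<in>ball z r \<inter> D. ennreal \<bar>f y - c\<bar> \<partial>lborel) \<le> ennreal e * emeasure lborel (ball z r \<inter> D)"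
      unfolding eventual_mean_deviation_le_def mem_Collect_eq eventually_at_right_field by blast
    then obtain n where n: "inverse (real (Suc n)) < \<delta>" using reals_Archimedean[OF \<delta>(1)] by blast
    have "z \<notin> G (1 / (real n + 1))"
    proof
      assume "z \<in> G (1 / (real n + 1))"
      then obtain r where r: "0 < r" "r < 1 / (real n + 1)" "ennreal e * emeasure lborel (ball z r \<inter> D)
          < (\<integral>\<^sup>+y\<in>ball z r \<inter> D. ennreal \<bar>f y - c\<bar> \<partial>lborel)"
        unfolding G_def mem_Collect_eq by (elim bexE) auto
      have "r < \<delta>" using r n by (simp add: inverse_eq_divide add.commute)
      then show False using \<delta>(2)[of r] r by (simp add: not_less[symmetric])
    qed
    then show "z \<in> (\<Union>n. - G (1 / (real n + 1)))" by blast
  next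
    fix z assume "z \<in> (\<Union>n. - G (1 / (real n + 1)))"
    then obtain n where n: "z \<notin> G (1 / (real n + 1))" by auto
    show "z \<in> {z. eventual_mean_deviation_le D f z c e}"
      unfolding eventual_mean_deviation_le_def mem_Collect_eq
      using n by (intro eventually_at_rightI[of _ "1 / (real n + 1)"]) (auto simp: G_def not_less)
  qed
  moreover have "(\<Union>n. - G (1 / (real n + 1))) \<in> sets borel"
    by (intro sets.countable_UN') (auto intro: borel_comp)
  ultimately show ?thesis by simp
qed

lemma lebesgue_value_unique:
  assumes "f \<in> borel_measurable borel" "D \<in> sets borel" "locally_nonnull_at D z"
    and "lebesgue_value D f z c" "lebesgue_value D f z c'"
  shows "c = c'"
proof -
  have "\<bar>c - c'\<bar> \<le> e + e" if "0 < e" for e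
    using assms that by (intro eventual_mean_deviation_le_dist) (auto simp: lebesgue_value_iff)
  from this[of "\<bar>c - c'\<bar> / 4"] show ?thesis by auto
qed

lemma lebesgue_version_eqI:
  assumes "f \<in> borel_measurable borel" "D \<in> sets borel" "locally_nonnull_at D z" "lebesgue_value D f z c"
  shows "lebesgue_version D f z = c"
  unfolding lebesgue_version_def using assms lebesgue_value_unique[OF assms(1-3)]
  by (auto intro!: the_equality)

text \<open>Approximate rational Lebesgue values suffice: those of precision \<open>1 / (n +
  1)\<close> form a Cauchy sequence, whose limit is a Lebesgue value. The gap \<open>1 / (m +
  1)\<close>, uniform in \<open>n\<close>, keeps the inequality with \<open>a\<close> strict in
  the limit.\<close>

lemma ex_lebesgue_value_less_iff:
  assumes f[measurable]: "f \<in> borel_measurable borel" and D[measurable]: "D \<in> sets borel" and fat: "locally_nonnull_at D z"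
  shows "(\<exists>c<a. lebesgue_value D f z c) \<longleftrightarrow>
    (\<exists>m::nat. \<forall>n::nat. \<exists>c::rat. of_rat c < a - 1 / (real m + 1) \<and>
       eventual_mean_deviation_le D f z (of_rat c) (1 / (real n + 1)))"
proof
  assume "\<exists>c<a. lebesgue_value D f z c"
  then obtain c where c: "c < a" "\<forall>e>0. eventual_mean_deviation_le D f z c e"
    using fat by (auto simp: lebesgue_value_iff)
  obtain m where m: "c < a - 1 / (real m + 1)"
    proof -
    obtain m where "inverse (real (Suc m)) < a - c" using reals_Archimedean[of "a - c"] c by auto
    then have "c < a - 1 / (real m + 1)" by (simp add: inverse_eq_divide add.commute)
    then show ?thesis by (rule that)
  qed
  show "\<exists>m::nat. \<forall>n::nat. \<exists>c::rat. of_rat c < a - 1 / (real m + 1) \<and>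
       eventual_mean_deviation_le D f z (of_rat c) (1 / (real n + 1))"
  proof (intro exI[of _ m] allI)
    fix n
    define \<delta> where "\<delta> = 1 / (2 * (real n + 1))"
    have \<delta>: "0 < \<delta>" "\<delta> + \<delta> = 1 / (real n + 1)" by (auto simp: \<delta>_def field_simps)
    obtain c' where c': "c - \<delta> < of_rat c'" "of_rat c' < c"
      using of_rat_dense[of "c - \<delta>" c] \<delta> by auto
    have "eventual_mean_deviation_le D f z (of_rat c') ((\<delta> + \<delta> - \<bar>c - of_rat c'\<bar>) + \<bar>c - of_rat c'\<bar>)"
      using c c' \<delta> by (intro eventual_mean_deviation_le_shift f D) auto
    then show "\<exists>c::rat. of_rat c < a - 1 / (real m + 1) \<and>
       eventual_mean_deviation_le D f z (of_rat c) (1 / (real n + 1))"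
      using c' m \<delta> by (intro exI[of _ c']) auto
  qed
next
  assume "\<exists>m::nat. \<forall>n::nat. \<exists>c::rat. of_rat c < a - 1 / (real m + 1) \<and>
       eventual_mean_deviation_le D f z (of_rat c) (1 / (real n + 1))"
  then obtain m :: nat and d :: "nat \<Rightarrow> rat" where
    d: "\<And>n. of_rat (d n) < a - 1 / (real m + 1)" "\<And>n. eventual_mean_deviation_le D f z (of_rat (d n)) (1 / (real n + 1))"
    unfolding choice_iff by blast
  define c :: "nat \<Rightarrow> real" where "c n = of_rat (d n)" for n
  have c: "c n < a - 1 / (real m + 1)" "eventual_mean_deviation_le D f z (c n) (1 / (real n + 1))" for n
    using d by (auto simp: c_def)
  have dist: "\<bar>c n - c k\<bar> \<le> 1 / (real n + 1) + 1 / (real k + 1)" for n k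
    using c by (intro eventual_mean_deviation_le_dist[OF f D _ _ _ _ fat]) auto
  have "Cauchy c"
    unfolding Cauchy_def
  proof (intro allI impI)
    fix e :: real assume "0 < e"
    then obtain N where N: "1 / (real N + 1) < e / 2"
      using reals_Archimedean[of "e / 2"] by (auto simp: inverse_eq_divide add.commute)
    have "dist (c n) (c k) < e" if "N \<le> n" "N \<le> k" for n k
    proof -
      have "1 / (real n + 1) \<le> 1 / (real N + 1)" "1 / (real k + 1) \<le> 1 / (real N + 1)"
        using that by (auto intro!: divide_left_mono)
      then show ?thesis using dist[of n k] N by (simp add: dist_real_def)
    qed
    then show "\<exists>N. \<forall>n\<ge>N. \<forall>k\<ge>N. dist (c n) (c k) < e" by blast
  qed
  then obtain l where l: "c \<longlonglongrightarrow> l" using Cauchy_convergent convergent_def by blast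
  have "l \<le> a - 1 / (real m + 1)"
    using c by (intro LIMSEQ_le_const2[OF l]) (auto intro: less_imp_le)
  then have "l < a" by (smt (verit) divide_pos_pos of_nat_0_le_iff)
  moreover have "lebesgue_value D f z l"
    unfolding lebesgue_value_iff[OF fat]
  proof (intro allI impI)
    fix e :: real assume "0 < e"
    have "(\<lambda>n. 1 / (real n + 1) + \<bar>c n - l\<bar>) \<longlonglongrightarrow> 0 + \<bar>l - l\<bar>"
      by (intro tendsto_intros l) real_asymp
    then have "\<forall>\<^sub>F n in sequentially. 1 / (real n + 1) + \<bar>c n - l\<bar> < e"
      using \<open>0 < e\<close> by (intro order_tendstoD) auto
    then obtain n where n: "1 / (real n + 1) + \<bar>c n - l\<bar> < e" by (auto dest: eventually_happens)
    have "eventual_mean_deviation_le D f z l (1 / (real n + 1) + \<bar>c n - l\<bar>)"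
      using c by (intro eventual_mean_deviation_le_shift f D) auto
    then show "eventual_mean_deviation_le D f z l e"
      unfolding eventual_mean_deviation_le_def
    proof eventually_elim
      case (elim r)
      then show ?case using n by (elim order_trans) (intro mult_right_mono ennreal_leI; simp)
    qed
  qed
  ultimately show "\<exists>c<a. lebesgue_value D f z c" by blast
qed

text \<open>Measurability holds everywhere and not just up to null sets. This matters: positions
  of the scheme are obtained by inserting random points into Lebesgue versions, and a kernel
  integral of a function that is not Borel is \<open>0\<close> by convention.\<close>

lemma borel_measurable_lebesgue_version:
  assumes f[measurable]: "f \<in> borel_measurable borel" and D[measurable]: "D \<in> sets borel" and fat: "\<And>z. z \<in> D \<Longrightarrow> locally_nonnull_at D z"
  shows "lebesgue_version D f \<in> borel_measurable (restrict_space borel D)"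
proof -
  define L where "L a = {z. \<exists>m::nat. \<forall>n::nat. \<exists>c::rat. of_rat c < a - 1 / (real m + 1) \<and>
       eventual_mean_deviation_le D f z (of_rat c) (1 / (real n + 1))}" for a
  have [measurable]: "{z. eventual_mean_deviation_le D f z c e} \<in> sets borel" for c e
    by (rule eventual_mean_deviation_le_sets[OF f D])
  have "L a = (\<Union>m. \<Inter>n. \<Union>c\<in>{c::rat. of_rat c < a - 1 / (real m + 1)}.
      {z. eventual_mean_deviation_le D f z (of_rat c) (1 / (real n + 1))})" for a
    unfolding L_def by (intro set_eqI) (simp only: mem_Collect_eq UN_iff INT_iff UNIV_I bex_UNIV ball_UNIV bex_simps Bex_def conj_assoc simp_thms)
  then have L[measurable]: "L a \<in> sets borel" for a
    by (simp only:) (intro sets.countable_UN sets.countable_INT sets.countable_UN' subsetI; auto)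
  have L_iff: "z \<in> L a \<longleftrightarrow> (\<exists>c<a. lebesgue_value D f z c)" if "z \<in> D" for z a
    using ex_lebesgue_value_less_iff[OF f D fat[OF that], of a] by (simp add: L_def)
  have ex: "(\<exists>c. lebesgue_value D f z c) \<longleftrightarrow> z \<in> (\<Union>n::nat. L (real n))" if "z \<in> D" for z
  proof
    assume "\<exists>c. lebesgue_value D f z c"
    then obtain c where c: "lebesgue_value D f z c" by blast
    obtain n :: nat where "c < real n" using reals_Archimedean2 by blast
    then have "z \<in> L (real n)" using c L_iff[OF that, of "real n"] by (intro iffD2[OF L_iff[OF that]] exI[of _ c] conjI)
    then show "z \<in> (\<Union>n::nat. L (real n))" by (rule UN_I[OF UNIV_I])
  next
    assume "z \<in> (\<Union>n::nat. L (real n))"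
    then obtain n where "z \<in> L (real n)" by (rule UN_E)
    then obtain c where "lebesgue_value D f z c" using iffD1[OF L_iff[OF \<open>z \<in> D\<close>]] by metis
    then show "\<exists>c. lebesgue_value D f z c" by (rule exI)
  qed
  have "lebesgue_version D f z < a \<longleftrightarrow> (z \<in> L a \<or> (z \<notin> (\<Union>n::nat. L (real n)) \<and> 0 < a))" if "z \<in> D" for z a
  proof (cases "\<exists>c. lebesgue_value D f z c")
    case True
    then obtain c where c: "lebesgue_value D f z c" by auto
    have "lebesgue_version D f z = c" using c by (intro lebesgue_version_eqI f D fat that)
    moreover have "z \<in> L a \<longleftrightarrow> c < a"
      unfolding L_iff[OF that] using c lebesgue_value_unique[OF f D fat[OF that] c] by metis
    ultimately show ?thesis using True ex[OF that] by simp
  next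
    case False
    moreover have "z \<notin> L a" unfolding L_iff[OF that] using False by blast
    ultimately show ?thesis using ex[OF that] by (simp add: lebesgue_version_def)
  qed
  then have "{z \<in> D. lebesgue_version D f z < a} =
      (if 0 < a then D \<inter> (L a \<union> - (\<Union>n::nat. L (real n))) else D \<inter> L a)" for a by auto
  moreover have "\<dots> a \<in> sets borel" for a using D by auto
  ultimately show ?thesis
    using D by (auto simp: borel_measurable_iff_less space_restrict_space sets_restrict_space_iff)
qed

text \<open>Apply differentiation to \<open>|f - c|\<close> for all rational \<open>c\<close> at
  once and let \<open>c\<close> approach \<open>f z\<close>. Truncation to the balls of radius
  \<open>n\<close> makes \<open>|f - c|\<close> integrable, and at interior points of
  \<open>D\<close> small balls are not cut by \<open>D\<close>.\<close>

lemma AE_lebesgue_version_eq: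
  assumes f[measurable]: "f \<in> borel_measurable borel" and D[measurable]: "D \<in> sets borel"
    and fin: "(\<integral>\<^sup>+z\<in>D. ennreal \<bar>f z\<bar> \<partial>lborel) < \<infinity>"
    and fat: "\<And>z. z \<in> D \<Longrightarrow> locally_nonnull_at D z" and frontier: "AE z in lborel. z \<in> D \<longrightarrow> z \<in> interior D"
  shows "AE z in lborel. z \<in> D \<longrightarrow> lebesgue_version D f z = f z"
proof -
  define h where "h c n z = ennreal \<bar>f z - c\<bar> * indicator (ball 0 (real n) \<inter> D) z" for c z and n :: nat
  have [measurable]: "ball 0 (real n) \<inter> D \<in> sets borel" for n by simp
  have [measurable]: "h c n \<in> borel_measurable borel" for c n unfolding h_def by measurable
  have fin_h: "(\<integral>\<^sup>+z. h c n z \<partial>lborel) < \<infinity>" for c n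
  proof -
    have "(\<integral>\<^sup>+z. h c n z \<partial>lborel) \<le> (\<integral>\<^sup>+z. ennreal \<bar>f z\<bar> * indicator D z
        + ennreal \<bar>c\<bar> * indicator (ball 0 (real n) \<inter> D) z \<partial>lborel)"
      by (intro nn_integral_mono) (auto simp: h_def split: split_indicator simp flip: ennreal_plus intro!: ennreal_leI)
    also have "\<dots> = (\<integral>\<^sup>+z\<in>D. ennreal \<bar>f z\<bar> \<partial>lborel) + ennreal \<bar>c\<bar> * emeasure lborel (ball 0 (real n) \<inter> D)"
      by (subst nn_integral_add) (auto simp: nn_integral_cmult)
    also have "\<dots> < \<infinity>"
      using fin emeasure_ball_Int_finite[of 0 "real n" D] by (auto simp: ennreal_mult_less_top)
    finally show ?thesis .
  qed
  have "AE z in lborel. \<forall>n::nat. \<forall>c::rat. \<forall>e::rat. 0 < e \<longrightarrow> h (of_rat c) n z < ennreal (of_rat e) \<longrightarrow>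
    (\<forall>\<^sub>F r in at_right 0. (\<integral>\<^sup>+y\<in>ball z r. h (of_rat c) n y \<partial>lborel) \<le> ennreal (of_rat e) * emeasure lborel (ball z r))"
    unfolding AE_all_countable using AE_eventually_ball_mean_le[OF _ fin_h] by auto
  with frontier show ?thesis
  proof eventually_elim
    case (elim z)
    show ?case
    proof
      assume "z \<in> D"
      with elim obtain \<epsilon> where \<epsilon>: "0 < \<epsilon>" "ball z \<epsilon> \<subseteq> D" by (auto simp: mem_interior)
      obtain n :: nat where n: "norm z + 1 < real n" using reals_Archimedean2 by blast
      have "eventual_mean_deviation_le D f z (f z) e" if "0 < e" for e
      proof -
        have "0 < e / 2" using \<open>0 < e\<close> by simp
        then obtain q where q: "0 < real_of_rat q" "of_rat q < e / 2" using of_rat_dense[of 0 "e / 2"] by (auto simp del: zero_less_of_rat_iff)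
        then have "0 < q" using zero_less_of_rat_iff by blast
        obtain c where c: "f z - of_rat q < of_rat c" "of_rat c < f z"
          using of_rat_dense[of "f z - of_rat q" "f z"] q by auto
        have "h (of_rat c) n z \<le> ennreal \<bar>f z - of_rat c\<bar>" by (auto simp: h_def split: split_indicator)
        also have "\<dots> < ennreal (of_rat q)" using c q by (intro ennreal_lessI) auto
        finally have "\<forall>\<^sub>F r in at_right 0. (\<integral>\<^sup>+y\<in>ball z r. h (of_rat c) n y \<partial>lborel) \<le> ennreal (of_rat q) * emeasure lborel (ball z r)"
          using elim \<open>0 < q\<close> by auto
        moreover have "\<forall>\<^sub>F r in at_right (0::real). r < min \<epsilon> 1"
          using \<epsilon> by (intro eventually_at_rightI[of _ "min \<epsilon> 1"]) auto
        ultimately have "eventual_mean_deviation_le D f z (of_rat c) (of_rat q)"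
          unfolding eventual_mean_deviation_le_def
        proof eventually_elim
          case (elim r)
          have "ball z r \<subseteq> ball z \<epsilon>" using elim by (intro subset_ball) auto
          with \<epsilon> have sub: "ball z r \<inter> D = ball z r" by blast
          have "x \<in> ball 0 (real n)" if "x \<in> ball z r" for x
            using that n elim norm_triangle_sub[of x z] by (auto simp: dist_norm norm_minus_commute)
          then have "(\<integral>\<^sup>+y\<in>ball z r. h (of_rat c) n y \<partial>lborel) = (\<integral>\<^sup>+y\<in>ball z r \<inter> D. ennreal \<bar>f y - of_rat c\<bar> \<partial>lborel)"
            using sub by (intro nn_integral_cong) (auto simp: h_def split: split_indicator)
          with elim sub show ?case by simp
        qed
        then have "eventual_mean_deviation_le D f z (f z) (of_rat q + \<bar>of_rat c - f z\<bar>)"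
          using q by (intro eventual_mean_deviation_le_shift f D) auto
        then show ?thesis
          unfolding eventual_mean_deviation_le_def
        proof eventually_elim
          case (elim r)
          have "of_rat q + \<bar>of_rat c - f z\<bar> \<le> e" using c q by auto
          then show ?case using elim by (elim order_trans) (intro mult_right_mono ennreal_leI; simp)
        qed
      qed
      then show "lebesgue_version D f z = f z"
        using \<open>z \<in> D\<close> by (intro lebesgue_version_eqI f D fat) (auto simp: lebesgue_value_iff fat)
    qed
  qed
qed

section \<open>The interaction field of a block-constant kernel\<close>

lemma locally_nonnull_at_strip:
  assumes "z \<in> {0..1::real} \<times> (UNIV :: 'a::euclidean_space set)"
  shows "locally_nonnull_at ({0..1} \<times> UNIV) z"
  unfolding locally_nonnull_at_def
proof (intro allI impI notI)
  fix r :: real assume r: "0 < r" and 0: "emeasure lborel (ball z r \<inter> {0..1} \<times> UNIV) = 0"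
  obtain u x where z: "z = (u, x)" "0 \<le> u" "u \<le> 1" using assms by (cases z) auto
  \<comment> \<open>A label in the open interval near \<open>u\<close>, which itself may be an endpoint.\<close>
  define u' where "u' = (if u < 1 / 2 then u + min (r / 2) (1 / 4) else u - min (r / 2) (1 / 4))"
  have u': "0 < u'" "u' < 1" "dist u u' < r"
    using z r by (cases "u < 1 / 2"; simp add: u'_def dist_real_def min_def)+
  let ?O = "ball z r \<inter> {0<..<1} \<times> (UNIV :: 'a set)"
  have "(u', x) \<in> ?O" using u' z by (simp add: dist_Pair_Pair)
  moreover have "open ?O" by (intro open_Int open_Times) auto
  ultimately have "\<not> negligible ?O" using open_not_negligible by blast
  moreover have "emeasure lborel ?O \<le> emeasure lborel (ball z r \<inter> {0..1} \<times> UNIV)"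
  proof (intro emeasure_mono)
    have "{0..1::real} \<times> (UNIV :: 'a set) \<in> sets borel" by (intro borel_closed closed_Times) auto
    then show "ball z r \<inter> {0..1} \<times> UNIV \<in> sets lborel" by simp
  qed auto
  then have "?O \<in> null_sets lborel" using 0 \<open>open ?O\<close> by auto
  ultimately show False
    using \<open>open ?O\<close> by (simp add: negligible_iff_null_sets null_sets_completion_iff)
qed

lemma AE_strip_interior:
  "AE z in lborel. z \<in> {0..1::real} \<times> (UNIV :: 'a::euclidean_space set) \<longrightarrow> z \<in> interior ({0..1} \<times> UNIV)"
proof -
  have "{0, 1::real} \<in> null_sets lborel" by (intro finite_imp_null_set_lborel) auto
  then have "{0, 1::real} \<times> (UNIV :: 'a set) \<in> null_sets (lborel \<Otimes>\<^sub>M lborel)"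
    by (intro lborel.times_in_null_sets1) auto
  then have "AE z in lborel. z \<notin> {0, 1::real} \<times> (UNIV :: 'a set)"
    unfolding lborel_prod by (rule AE_not_in)
  then show ?thesis
  proof eventually_elim
    case (elim z)
    show ?case
    proof
      assume "z \<in> {0..1::real} \<times> (UNIV :: 'a set)"
      with elim have "z \<in> {0<..<1} \<times> UNIV" by (cases z) (auto simp: less_le)
      moreover have "open ({0<..<1::real} \<times> (UNIV :: 'a set))" by (intro open_Times) auto
      ultimately show "z \<in> interior ({0..1} \<times> UNIV)" by (intro interiorI) auto
    qed
  qed
qed

lemma lebesgue_version_cong:
  assumes "\<And>z. z \<in> D \<Longrightarrow> f z = g z"
  shows "lebesgue_version D f = lebesgue_version D g"
proof -
  have "(\<integral>\<^sup>+y\<in>ball z r \<inter> D. ennreal \<bar>f y - c\<bar> \<partial>lborel) = (\<integral>\<^sup>+y\<in>ball z r \<inter> D. ennreal \<bar>g y - c\<bar> \<partial>lborel)" for z r c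
    using assms by (intro nn_integral_cong) (auto split: split_indicator)
  then have "lebesgue_value D f = lebesgue_value D g" by (intro ext) (simp add: lebesgue_value_def)
  then show ?thesis by (intro ext) (simp add: lebesgue_version_def)
qed

lemma interaction_kernel_unit_measures:
  assumes "interaction_kernel K" "u \<in> {0..1}"
  shows "K u \<in> unit_measures"
proof -
  have "K u \<in> space (borel_of_topology tv_topology)"
    using assms by (auto simp: interaction_kernel_def space_restrict_space intro!: measurable_space[of K unit_borel])
  also have "\<dots> = topspace tv_topology"
    unfolding borel_of_topology_def by (rule space_measure_of) (auto dest: openin_subset)
  also have "\<dots> = unit_measures"
    unfolding tv_topology_def by (rule Metric_space.topspace_mtopology[OF Metric_space_tv])
  finally show ?thesis .
qed

definition block_constant :: "'j set \<Rightarrow> ('j \<Rightarrow> real set) \<Rightarrow> (real \<Rightarrow> 'c) \<Rightarrow> bool" where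
  "block_constant J A f \<longleftrightarrow> (\<forall>j\<in>J. \<forall>u\<in>A j. \<forall>v\<in>A j. f u = f v)"

definition borel_partition :: "'j set \<Rightarrow> ('j \<Rightarrow> real set) \<Rightarrow> bool" where
  "borel_partition J A \<longleftrightarrow> countable J \<and> (\<forall>j\<in>J. A j \<in> sets borel) \<and> disjoint_family_on A J \<and> (\<Union>j\<in>J. A j) = {0..1}"

text \<open>On a block the kernel is one fixed finite measure, so there the integral is Borel in
  \<open>x\<close> by Fubini and does not depend on \<open>u\<close>; countably many such pieces
  are glued together. The indicator extends the function by \<open>0\<close> to all real labels.\<close>

lemma borel_measurable_kernel_integral:
  fixes \<rho> :: "'a::euclidean_space \<Rightarrow> real \<Rightarrow> real"
  assumes P: "borel_partition J A" and K: "block_constant J A K" "\<And>u. u \<in> {0..1} \<Longrightarrow> K u \<in> unit_measures"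
    and \<rho>: "(\<lambda>(x, v). \<rho> x v) \<in> borel_measurable (borel \<Otimes>\<^sub>M unit_borel)"
  shows "(\<lambda>(u, x). indicator {0..1} u * (LINT v|K u. \<rho> x v)) \<in> borel_measurable (borel \<Otimes>\<^sub>M borel)"
    (is "?g \<in> _")
proof (rule measurable_piecewise_restrict)
  let ?C = "insert ((- {0..1}) \<times> UNIV) ((\<lambda>j. A j \<times> (UNIV :: 'a set)) ` {j \<in> J. A j \<noteq> {}})"
  show "countable ?C" using P unfolding borel_partition_def by (intro countable_insert countable_image) (auto intro: countable_subset)
  have A: "A j \<in> sets borel" "A j \<subseteq> {0..1}" if "j \<in> J" for j
    using P that by (auto simp: borel_partition_def)
  show "space (borel \<Otimes>\<^sub>M borel) \<subseteq> \<Union>?C"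
  proof
    fix z :: "real \<times> 'a"
    show "z \<in> \<Union>?C"
    proof (cases "fst z \<in> {0..1}")
      case True
      then obtain j where "j \<in> J" "fst z \<in> A j" using P unfolding borel_partition_def by blast
      then show ?thesis by (intro UnionI[of "A j \<times> UNIV"]) (auto simp: mem_Times_iff)
    next
      case False
      then show ?thesis by (intro UnionI[of "(- {0..1}) \<times> UNIV"]) (auto simp: mem_Times_iff)
    qed
  qed
  show "\<Omega> \<inter> space (borel \<Otimes>\<^sub>M borel) \<in> sets (borel \<Otimes>\<^sub>M borel)" if "\<Omega> \<in> ?C" for \<Omega>
    using that A by (auto simp: space_pair_measure)
  show "?g \<in> borel_measurable (restrict_space (borel \<Otimes>\<^sub>M borel) \<Omega>)" if "\<Omega> \<in> ?C" for \<Omega>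
  proof -
    consider "\<Omega> = (- {0..1}) \<times> UNIV" | j where "j \<in> J" "A j \<noteq> {}" "\<Omega> = A j \<times> UNIV" using \<open>\<Omega> \<in> ?C\<close> by blast
    then show ?thesis
    proof cases
      case 1
      then have "?g \<in> borel_measurable (restrict_space (borel \<Otimes>\<^sub>M borel) \<Omega>) \<longleftrightarrow>
          (\<lambda>_. 0 :: real) \<in> borel_measurable (restrict_space (borel \<Otimes>\<^sub>M borel) \<Omega> :: (real \<times> 'a) measure)"
        by (intro measurable_cong) (auto simp: space_restrict_space)
      then show ?thesis by simp
    next
      case 2
      from \<open>A j \<noteq> {}\<close> obtain a where a: "a \<in> A j" by auto
      then have "K a \<in> unit_measures" using A[OF \<open>j \<in> J\<close>] K by auto
      then have fin: "finite_measure (K a)" and sets: "sets (K a) = sets unit_borel"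
        by (auto simp: unit_measures_def)
      interpret finite_measure "K a" by fact
      have [measurable]: "(\<lambda>(x, v). \<rho> x v) \<in> borel_measurable (borel \<Otimes>\<^sub>M K a)"
        unfolding measurable_cong_sets[OF sets_pair_measure_cong[OF refl sets] refl] by (rule \<rho>)
      have "(\<lambda>(u :: real, x). LINT v|K a. \<rho> x v) \<in> borel_measurable (borel \<Otimes>\<^sub>M borel)"
        by measurable
      then have meas: "(\<lambda>(u, x). LINT v|K a. \<rho> x v) \<in> borel_measurable (restrict_space (borel \<Otimes>\<^sub>M borel) \<Omega>)"
        by (rule measurable_restrict_space1)
      have cong: "?g z = (\<lambda>(u, x). LINT v|K a. \<rho> x v) z"
        if "z \<in> space (restrict_space (borel \<Otimes>\<^sub>M borel) \<Omega>)" for z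
      proof -
        obtain u x where z: "z = (u, x)" by (cases z)
        then have u: "u \<in> A j" using that 2 by (simp add: space_restrict_space)
        then have "K u = K a" using K(1) a u 2 unfolding block_constant_def by blast
        moreover have "u \<in> {0..1}" using u A[OF \<open>j \<in> J\<close>] by auto
        ultimately show ?thesis using z by simp
      qed
      show ?thesis by (rule iffD2[OF measurable_cong[OF cong] meas])
    qed
  qed
qed

lemma interaction_eq_lebesgue_version:
  "interaction K \<rho> u x =
     lebesgue_version ({0..1} \<times> UNIV) (\<lambda>(u, x). indicator {0..1} u * (LINT v|K u. \<rho> x v)) (u, x)"
  unfolding interaction_def by (rule fun_cong[OF lebesgue_version_cong]) auto

lemma borel_measurable_interaction:
  fixes \<rho> :: "real^'d \<Rightarrow> real \<Rightarrow> real"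
  assumes P: "borel_partition J A" and K: "block_constant J A K" "\<And>u. u \<in> {0..1} \<Longrightarrow> K u \<in> unit_measures"
    and \<rho>: "(\<lambda>(x, v). \<rho> x v) \<in> borel_measurable (borel \<Otimes>\<^sub>M unit_borel)"
  shows "(\<lambda>(u, x). interaction K \<rho> u x) \<in> borel_measurable (unit_borel \<Otimes>\<^sub>M borel)"
proof -
  let ?D = "{0..1::real} \<times> (UNIV :: (real^'d) set)"
  have "(\<lambda>z. lebesgue_version ?D (\<lambda>(u, x). indicator {0..1} u * (LINT v|K u. \<rho> x v)) z)
      \<in> borel_measurable (restrict_space borel ?D)"
    using borel_measurable_kernel_integral[OF assms]
    by (intro borel_measurable_lebesgue_version locally_nonnull_at_strip)
      (auto simp: borel_prod intro!: borel_closed closed_Times)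
  moreover have "(\<lambda>z. z) \<in> measurable (unit_borel \<Otimes>\<^sub>M (borel :: (real^'d) measure)) (restrict_space borel ?D)"
  proof (rule measurable_restrict_space2)
    have "(\<lambda>u. u) \<in> measurable unit_borel borel" by (rule measurable_restrict_space1) simp
    then have "(\<lambda>z. (fst z, snd z)) \<in> measurable (unit_borel \<Otimes>\<^sub>M (borel :: (real^'d) measure)) (borel \<Otimes>\<^sub>M borel)"
      by (intro measurable_Pair measurable_compose[OF measurable_fst] measurable_snd)
    then show "(\<lambda>z. z) \<in> measurable (unit_borel \<Otimes>\<^sub>M (borel :: (real^'d) measure)) borel"
      by (simp add: borel_prod)
  qed (auto simp: space_pair_measure space_restrict_space)
  ultimately have "(\<lambda>z. lebesgue_version ?D (\<lambda>(u, x). indicator {0..1} u * (LINT v|K u. \<rho> x v)) z)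
      \<in> borel_measurable (unit_borel \<Otimes>\<^sub>M borel)"
    by (rule measurable_compose[rotated])
  then show ?thesis by (simp add: interaction_eq_lebesgue_version case_prod_beta')
qed

text \<open>The kernel integral is integrable on the strip: for almost every \<open>x\<close>
  the profile \<open>\<rho> x\<close> is integrable in the label, the bound on
  \<open>L\<^sup>1\<close> controls its image under the kernel by a multiple of its mass, and
  the total mass of \<open>\<rho>\<close> is \<open>1\<close>. Lebesgue differentiation on the
  strip, disintegrated by Fubini, gives the claim.\<close>

lemma AE_interaction_eq:
  fixes \<rho> :: "real^'d \<Rightarrow> real \<Rightarrow> real"
  assumes P: "borel_partition J A" and K: "block_constant J A K" "\<And>u. u \<in> {0..1} \<Longrightarrow> K u \<in> unit_measures"
    and bdd: "bounded_on_L1 K"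
    and \<rho>: "(\<lambda>(x, v). \<rho> x v) \<in> borel_measurable (borel \<Otimes>\<^sub>M unit_borel)"
    and nonneg: "\<And>x v. v \<in> {0..1} \<Longrightarrow> 0 \<le> \<rho> x v"
    and one: "\<And>v. v \<in> {0..1} \<Longrightarrow> (\<integral>\<^sup>+x. ennreal (\<rho> x v) \<partial>lborel) = 1"
  shows "AE u in lborel. u \<in> {0..1} \<longrightarrow> (AE x in lborel. interaction K \<rho> u x = (LINT v|K u. \<rho> x v))"
proof -
  let ?D = "{0..1::real} \<times> (UNIV :: (real^'d) set)"
  define g where "g = (\<lambda>(u, x). indicator {0..1} u * (LINT v|K u. \<rho> x v))"
  have g[measurable]: "g \<in> borel_measurable (borel \<Otimes>\<^sub>M borel)"
    unfolding g_def by (rule borel_measurable_kernel_integral[OF P K \<rho>])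
  have D: "?D \<in> sets borel" by (intro borel_closed closed_Times) auto
  interpret unit: sigma_finite_measure unit_lborel
    by (intro sigma_finite_measure_restrict_space lborel.sigma_finite_measure_axioms) auto
  interpret pair: pair_sigma_finite "lborel :: (real^'d) measure" unit_lborel ..
  have sets_unit: "sets unit_lborel = sets unit_borel" by (simp add: sets_restrict_space)
  have \<rho>1[measurable]: "(\<lambda>(x, v). \<rho> x v) \<in> borel_measurable (lborel \<Otimes>\<^sub>M unit_lborel)"
    unfolding measurable_cong_sets[OF sets_pair_measure_cong[OF sets_lborel sets_unit] refl] by (rule \<rho>)
  have mass: "(\<integral>\<^sup>+x. \<integral>\<^sup>+v. ennreal (\<rho> x v) \<partial>unit_lborel \<partial>lborel) = 1"
  proof -
    have "(\<integral>\<^sup>+x. \<integral>\<^sup>+v. ennreal (\<rho> x v) \<partial>unit_lborel \<partial>lborel) = (\<integral>\<^sup>+v. \<integral>\<^sup>+x. ennreal (\<rho> x v) \<partial>lborel \<partial>unit_lborel)"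
      using pair.Fubini[of "\<lambda>(x, v). ennreal (\<rho> x v)"] by simp
    also have "\<dots> = (\<integral>\<^sup>+v. 1 \<partial>unit_lborel)"
      by (intro nn_integral_cong one) (simp add: space_restrict_space)
    also have "\<dots> = 1" by (simp add: emeasure_restrict_space space_restrict_space)
    finally show ?thesis .
  qed
  obtain C where C: "\<And>\<phi> :: real \<Rightarrow> real. integrable unit_lborel \<phi> \<Longrightarrow> integrable unit_lborel (\<lambda>u. LINT v|K u. \<phi> v) \<and>
     (LINT u|unit_lborel. \<bar>LINT v|K u. \<phi> v\<bar>) \<le> C * (LINT u|unit_lborel. \<bar>\<phi> u\<bar>)"
    using bdd unfolding bounded_on_L1_def by blast
  have "(\<integral>\<^sup>+z\<in>?D. ennreal \<bar>g z\<bar> \<partial>lborel) = (\<integral>\<^sup>+z. ennreal \<bar>g z\<bar> \<partial>(lborel \<Otimes>\<^sub>M lborel))"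
    unfolding lborel_prod by (intro nn_integral_cong) (auto simp: g_def indicator_def split: if_splits)
  also have "\<dots> = (\<integral>\<^sup>+x. \<integral>\<^sup>+u. ennreal \<bar>g (u, x)\<bar> \<partial>lborel \<partial>lborel)"
    by (intro lborel_pair.nn_integral_snd[symmetric]) measurable
  also have "\<dots> \<le> (\<integral>\<^sup>+x. ennreal \<bar>C\<bar> * (\<integral>\<^sup>+v. ennreal (\<rho> x v) \<partial>unit_lborel) \<partial>lborel)"
  proof (rule nn_integral_mono_AE)
    have "AE x in lborel. (\<integral>\<^sup>+v. ennreal (\<rho> x v) \<partial>unit_lborel) \<noteq> \<infinity>"
      using mass by (intro nn_integral_PInf_AE) auto
    then show "AE x in lborel. (\<integral>\<^sup>+u. ennreal \<bar>g (u, x)\<bar> \<partial>lborel) \<le> ennreal \<bar>C\<bar> * (\<integral>\<^sup>+v. ennreal (\<rho> x v) \<partial>unit_lborel)"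
    proof eventually_elim
      case (elim x)
      have [measurable]: "\<rho> x \<in> borel_measurable unit_lborel"
        using measurable_Pair_compose_split[OF \<rho>1, of "\<lambda>_. x" unit_lborel "\<lambda>v. v"] by simp
      have abs: "(\<integral>\<^sup>+v. ennreal \<bar>\<rho> x v\<bar> \<partial>unit_lborel) = (\<integral>\<^sup>+v. ennreal (\<rho> x v) \<partial>unit_lborel)"
        using nonneg by (intro nn_integral_cong) (auto simp: space_restrict_space)
      have int: "integrable unit_lborel (\<rho> x)"
        using elim abs by (auto simp: integrable_iff_bounded less_top)
      have "(\<integral>\<^sup>+u. ennreal \<bar>g (u, x)\<bar> \<partial>lborel) = (\<integral>\<^sup>+u. ennreal \<bar>LINT v|K u. \<rho> x v\<bar> \<partial>unit_lborel)"
        by (subst nn_integral_restrict_space) (auto simp: g_def split: split_indicator intro!: nn_integral_cong)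
      also have "\<dots> = ennreal (LINT u|unit_lborel. \<bar>LINT v|K u. \<rho> x v\<bar>)"
        using C[OF int] by (intro nn_integral_eq_integral) auto
      also have "\<dots> \<le> ennreal (\<bar>C\<bar> * (LINT v|unit_lborel. \<bar>\<rho> x v\<bar>))"
      proof (intro ennreal_leI)
        have "(LINT u|unit_lborel. \<bar>LINT v|K u. \<rho> x v\<bar>) \<le> C * (LINT v|unit_lborel. \<bar>\<rho> x v\<bar>)"
          using C[OF int] by simp
        also have "\<dots> \<le> \<bar>C\<bar> * (LINT v|unit_lborel. \<bar>\<rho> x v\<bar>)"
          by (intro mult_right_mono integral_nonneg_AE) auto
        finally show "(LINT u|unit_lborel. \<bar>LINT v|K u. \<rho> x v\<bar>) \<le> \<bar>C\<bar> * (LINT v|unit_lborel. \<bar>\<rho> x v\<bar>)" .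
      qed
      also have "\<dots> = ennreal \<bar>C\<bar> * ennreal (LINT v|unit_lborel. \<bar>\<rho> x v\<bar>)"
        by (intro ennreal_mult) (auto intro: integral_nonneg_AE)
      also have "ennreal (LINT v|unit_lborel. \<bar>\<rho> x v\<bar>) = (\<integral>\<^sup>+v. ennreal \<bar>\<rho> x v\<bar> \<partial>unit_lborel)"
        using int by (intro nn_integral_eq_integral[symmetric]) auto
      finally show ?case unfolding abs .
    qed
  qed
  also have "\<dots> = ennreal \<bar>C\<bar>" by (subst nn_integral_cmult) (auto simp: mass)
  finally have "(\<integral>\<^sup>+z\<in>?D. ennreal \<bar>g z\<bar> \<partial>lborel) < \<infinity>" by (simp add: le_less_trans)
  then have "AE z in lborel. z \<in> ?D \<longrightarrow> lebesgue_version ?D g z = g z"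
    using g D by (intro AE_lebesgue_version_eq locally_nonnull_at_strip AE_strip_interior) (auto simp: borel_prod)
  then have "AE u in lborel. AE x in lborel. (u, x) \<in> ?D \<longrightarrow> lebesgue_version ?D g (u, x) = g (u, x)"
    unfolding lborel_prod[symmetric] by (rule lborel_pair.AE_pair)
  then show ?thesis
  proof eventually_elim
    case (elim u)
    show ?case
    proof
      assume u: "u \<in> {0..1}"
      from elim show "AE x in lborel. interaction K \<rho> u x = (LINT v|K u. \<rho> x v)"
        by eventually_elim (use u in \<open>simp add: interaction_eq_lebesgue_version g_def\<close>)
    qed
  qed
qed

section \<open>Continuous densities and laws\<close>

text \<open>A continuous density is recovered pointwise from the measure. Besides uniqueness,
  this formula transfers measurability from a family of laws to the family of their densities.\<close>

lemma continuous_density_ball_mean_tendsto: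
  fixes f :: "'a::euclidean_space \<Rightarrow> real"
  assumes f: "continuous_on UNIV f" "\<And>x. 0 \<le> f x"
    and N: "N = density lborel (\<lambda>x. ennreal (f x))" and "finite_measure N"
  shows "(\<lambda>n. measure N (ball x (1 / (real n + 1))) / measure lborel (ball x (1 / (real n + 1)))) \<longlonglongrightarrow> f x"
proof (rule LIMSEQ_I)
  fix e :: real assume "0 < e"
  interpret finite_measure N by fact
  have [measurable]: "f \<in> borel_measurable borel" using f by (simp add: borel_measurable_continuous_onI)
  obtain d where d: "0 < d" "\<And>y. dist y x < d \<Longrightarrow> dist (f y) (f x) < e / 2"
    using f(1) \<open>0 < e\<close> by (metis UNIV_I continuous_on_iff half_gt_zero)
  obtain m where m: "inverse (real (Suc m)) < d" using reals_Archimedean[OF d(1)] by blast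
  show "\<exists>m. \<forall>n\<ge>m. norm (measure N (ball x (1 / (real n + 1))) / measure lborel (ball x (1 / (real n + 1))) - f x) < e"
  proof (intro exI[of _ m] allI impI)
    fix n assume "m \<le> n"
    define B where "B = ball x (1 / (real n + 1))"
    define V where "V = measure lborel B"
    have "1 / (real n + 1) \<le> inverse (real (Suc m))"
      using \<open>m \<le> n\<close> by (simp add: inverse_eq_divide field_simps)
    then have near: "\<bar>f y - f x\<bar> < e / 2" if "y \<in> B" for y
      using d(2)[of y] m that by (simp add: B_def dist_commute dist_real_def abs_minus_commute)
    have near': "f y \<le> f x + e / 2" "f x - e / 2 \<le> f y" if "y \<in> B" for y
      using near[OF that] by linarith+
    have B[measurable]: "B \<in> sets borel" by (simp add: B_def)
    have V: "emeasure lborel B = ennreal V"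
      using emeasure_lborel_ball_finite[of x "1 / (real n + 1)"] by (simp add: V_def B_def emeasure_eq_ennreal_measure less_top)
    have "0 < V" by (simp add: V_def B_def content_ball_pos)
    have N_B: "ennreal (measure N B) = (\<integral>\<^sup>+y. ennreal (f y) * indicator B y \<partial>lborel)"
      unfolding emeasure_eq_measure[symmetric] by (simp add: N emeasure_density)
    have "ennreal (measure N B) \<le> (\<integral>\<^sup>+y. ennreal (f x + e / 2) * indicator B y \<partial>lborel)"
      unfolding N_B using near' by (intro nn_integral_mono) (auto split: split_indicator intro!: ennreal_leI)
    also have "\<dots> = ennreal ((f x + e / 2) * V)"
      using f(2)[of x] \<open>0 < e\<close> \<open>0 < V\<close> by (simp add: nn_integral_cmult V ennreal_mult)
    finally have upper: "measure N B \<le> (f x + e / 2) * V"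
      using f(2)[of x] \<open>0 < e\<close> \<open>0 < V\<close> by (subst (asm) ennreal_le_iff) auto
    have "ennreal ((f x - e / 2) * V) = ennreal (f x - e / 2) * ennreal V"
      using \<open>0 < V\<close> by (simp add: ennreal_mult'')
    also have "\<dots> = (\<integral>\<^sup>+y. ennreal (f x - e / 2) * indicator B y \<partial>lborel)"
      by (simp add: nn_integral_cmult V)
    also have "\<dots> \<le> ennreal (measure N B)"
      unfolding N_B using near' by (intro nn_integral_mono) (auto split: split_indicator intro!: ennreal_leI)
    finally have lower: "(f x - e / 2) * V \<le> measure N B" by simp
    have "\<bar>measure N B / V - f x\<bar> \<le> e / 2"
    proof -
      have "measure N B / V \<le> f x + e / 2" using upper \<open>0 < V\<close> by (simp only: pos_divide_le_eq)
      moreover have "f x - e / 2 \<le> measure N B / V" using lower \<open>0 < V\<close> by (simp only: pos_le_divide_eq)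
      ultimately show ?thesis by linarith
    qed
    then show "norm (measure N (ball x (1 / (real n + 1))) / measure lborel (ball x (1 / (real n + 1))) - f x) < e"
      using \<open>0 < e\<close> by (simp add: B_def V_def)
  qed
qed

lemma continuous_density_unique:
  fixes f g :: "'a::euclidean_space \<Rightarrow> real"
  assumes "continuous_on UNIV f" "\<And>x. 0 \<le> f x" "continuous_on UNIV g" "\<And>x. 0 \<le> g x"
    and "N = density lborel (\<lambda>x. ennreal (f x))" "N = density lborel (\<lambda>x. ennreal (g x))" "finite_measure N"
  shows "f = g"
  using continuous_density_ball_mean_tendsto[OF assms(1,2,5,7)]
    continuous_density_ball_mean_tendsto[OF assms(3,4,6,7)] LIMSEQ_unique by blast

lemma borel_measurable_joint_density:
  fixes Y :: "real \<Rightarrow> 'w \<Rightarrow> 'a::euclidean_space" and \<rho> :: "'a \<Rightarrow> real \<Rightarrow> real"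
  assumes M: "prob_space M"
    and Y: "(\<lambda>(u, \<omega>). Y u \<omega>) \<in> borel_measurable (unit_borel \<Otimes>\<^sub>M M)"
    and Y1: "\<And>u. u \<in> {0..1} \<Longrightarrow> Y u \<in> borel_measurable M"
    and \<rho>: "\<And>u. u \<in> {0..1} \<Longrightarrow> continuous_on UNIV (\<lambda>x. \<rho> x u)" "\<And>u x. u \<in> {0..1} \<Longrightarrow> 0 \<le> \<rho> x u"
    and law: "\<And>u. u \<in> {0..1} \<Longrightarrow> distr M borel (Y u) = density lborel (\<lambda>x. ennreal (\<rho> x u))"
  shows "(\<lambda>(x, u). \<rho> x u) \<in> borel_measurable (borel \<Otimes>\<^sub>M unit_borel)"
proof -
  interpret prob_space M by fact
  define F where "F n z = (LINT \<omega>|M. (if dist (fst z) (Y (snd z) \<omega>) < 1 / (real n + 1) then 1 else 0 :: real))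
      / measure lborel (ball (0 :: 'a) (1 / (real n + 1)))" for n and z :: "'a \<times> real"
  have [measurable]: "(\<lambda>z :: ('a \<times> real) \<times> 'w. Y (snd (fst z)) (snd z)) \<in> borel_measurable ((borel \<Otimes>\<^sub>M unit_borel) \<Otimes>\<^sub>M M)"
  proof -
    have "(\<lambda>z :: ('a \<times> real) \<times> 'w. (snd (fst z), snd z)) \<in> measurable ((borel \<Otimes>\<^sub>M unit_borel) \<Otimes>\<^sub>M M) (unit_borel \<Otimes>\<^sub>M M)"
      by measurable
    from measurable_compose[OF this Y] show ?thesis by simp
  qed
  have vol: "measure lborel (ball x (1 / (real n + 1))) = measure lborel (ball (0 :: 'a) (1 / (real n + 1)))" for x :: 'a and n
    by (simp add: content_ball)
  have F: "F n \<in> borel_measurable (borel \<Otimes>\<^sub>M unit_borel)" for n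
    unfolding F_def by measurable
  show ?thesis
  proof (rule borel_measurable_LIMSEQ_real[OF _ F])
    fix z :: "'a \<times> real" assume "z \<in> space (borel \<Otimes>\<^sub>M unit_borel)"
    then obtain x u where z: "z = (x, u)" "u \<in> {0..1}" by (cases z) (auto simp: space_pair_measure space_restrict_space)
    have [measurable]: "Y u \<in> borel_measurable M" using Y1 z by auto
    interpret D: prob_space "distr M borel (Y u)" by (intro prob_space_distr) simp
    have "F n z = measure (distr M borel (Y u)) (ball x (1 / (real n + 1))) / measure lborel (ball x (1 / (real n + 1)))" for n
    proof -
      have "(LINT \<omega>|M. (if dist x (Y u \<omega>) < 1 / (real n + 1) then 1 else 0 :: real))
        = (LINT \<omega>|M. indicator (Y u -` ball x (1 / (real n + 1)) \<inter> space M) \<omega>)"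
        by (intro Bochner_Integration.integral_cong) (auto split: split_indicator)
      also have "\<dots> = measure (distr M borel (Y u)) (ball x (1 / (real n + 1)))"
        by (simp add: measure_distr)
      finally show ?thesis by (simp add: F_def z vol[of x])
    qed
    then show "(\<lambda>n. F n z) \<longlonglongrightarrow> (case z of (x, u) \<Rightarrow> \<rho> x u)"
      using continuous_density_ball_mean_tendsto[OF \<rho>(1)[OF z(2)] \<rho>(2)[OF z(2)] law[OF z(2)] D.finite_measure_axioms, of x]
      by (simp add: z)
  qed
qed

section \<open>Laws of the Euler scheme along a block\<close>

lemma borel_partition_label: "borel_partition J A \<Longrightarrow> j \<in> J \<Longrightarrow> u \<in> A j \<Longrightarrow> u \<in> {0..1}"
  unfolding borel_partition_def by blast

text \<open>The invariant of the induction along the scheme. Joint measurability makes the densities Borel in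
  the label, measurability with respect to the past \<open>G\<close> gives independence of the next increment,
  and the null set of labels absorbs the failures of Lebesgue differentiation, which differ from
  step to step.\<close>

definition block_law_process ::
    "'w measure \<Rightarrow> 'w measure \<Rightarrow> 'j set \<Rightarrow> ('j \<Rightarrow> real set) \<Rightarrow> (real \<Rightarrow> 'w \<Rightarrow> 'a::euclidean_space) \<Rightarrow> bool" where
  "block_law_process M G J A Y \<longleftrightarrow>
     (\<lambda>(u, \<omega>). Y u \<omega>) \<in> borel_measurable (unit_borel \<Otimes>\<^sub>M M) \<and>
     (\<forall>u\<in>{0..1}. Y u \<in> borel_measurable G) \<and>
     (\<exists>Z\<in>null_sets lborel. \<forall>j\<in>J. \<forall>u\<in>A j - Z. \<forall>v\<in>A j - Z. distr M borel (Y u) = distr M borel (Y v))"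

lemma block_law_processI:
  assumes "(\<lambda>(u, \<omega>). Y u \<omega>) \<in> borel_measurable (unit_borel \<Otimes>\<^sub>M M)"
    and "\<And>u. u \<in> {0..1} \<Longrightarrow> Y u \<in> borel_measurable G"
    and "Z \<in> null_sets lborel"
    and "\<And>j u v. j \<in> J \<Longrightarrow> u \<in> A j - Z \<Longrightarrow> v \<in> A j - Z \<Longrightarrow> distr M borel (Y u) = distr M borel (Y v)"
  shows "block_law_process M G J A Y"
  unfolding block_law_process_def by (intro conjI ballI bexI[of _ Z] assms)

lemma block_law_processD:
  assumes "block_law_process M G J A Y"
  shows "(\<lambda>(u, \<omega>). Y u \<omega>) \<in> borel_measurable (unit_borel \<Otimes>\<^sub>M M)"
    and "u \<in> {0..1} \<Longrightarrow> Y u \<in> borel_measurable G"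
  using assms unfolding block_law_process_def by blast+

lemma block_law_processE:
  assumes "block_law_process M G J A Y"
  obtains Z where "Z \<in> null_sets lborel"
    "\<And>j u v. j \<in> J \<Longrightarrow> u \<in> A j - Z \<Longrightarrow> v \<in> A j - Z \<Longrightarrow> distr M borel (Y u) = distr M borel (Y v)"
  using assms unfolding block_law_process_def by blast

lemma block_law_process_cong:
  assumes Y: "block_law_process M G J A Y" and G: "subalgebra M G" and P: "borel_partition J A"
    and eq: "\<And>u \<omega>. u \<in> {0..1} \<Longrightarrow> \<omega> \<in> space M \<Longrightarrow> Y' u \<omega> = Y u \<omega>"
  shows "block_law_process M G J A Y'"
proof -
  have space_G: "space G = space M" using G by (simp add: subalgebra_def)
  have d: "distr M borel (Y' u) = distr M borel (Y u)" if "u \<in> {0..1}" for u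
    using eq[OF that] by (intro distr_cong) auto
  have joint: "(\<lambda>(u, \<omega>). Y' u \<omega>) \<in> borel_measurable (unit_borel \<Otimes>\<^sub>M M) \<longleftrightarrow> (\<lambda>(u, \<omega>). Y u \<omega>) \<in> borel_measurable (unit_borel \<Otimes>\<^sub>M M)"
    using eq by (intro measurable_cong) (auto simp: space_pair_measure space_restrict_space)
  have adapted: "Y' u \<in> borel_measurable G \<longleftrightarrow> Y u \<in> borel_measurable G" if "u \<in> {0..1}" for u
    using eq that space_G by (intro measurable_cong) auto
  obtain Z where Z: "Z \<in> null_sets lborel" "\<And>j u v. j \<in> J \<Longrightarrow> u \<in> A j - Z \<Longrightarrow> v \<in> A j - Z \<Longrightarrow> distr M borel (Y u) = distr M borel (Y v)"
    using block_law_processE[OF Y] by blast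
  have laws: "distr M borel (Y' u) = distr M borel (Y' v)" if "j \<in> J" "u \<in> A j - Z" "v \<in> A j - Z" for j u v
  proof -
    have "u \<in> {0..1}" "v \<in> {0..1}" using that borel_partition_label[OF P] by blast+
    then show ?thesis using d Z(2)[OF that] by simp
  qed
  show ?thesis
    using block_law_processD[OF Y] by (intro block_law_processI[OF _ _ Z(1) laws]) (simp_all only: joint adapted)
qed

text \<open>By independence, the law of the sum is a function of the two marginal laws alone.\<close>

lemma distr_add_indep_increment:
  fixes X Y V :: "'w \<Rightarrow> 'a::euclidean_space"
  assumes M: "prob_space M" and G: "subalgebra M G"
    and X: "X \<in> borel_measurable G" and V: "V \<in> borel_measurable M"
    and indep: "prob_space.indep_set M (sets G) (sets (vimage_algebra (space M) V borel))"
  shows "distr M borel (\<lambda>\<omega>. X \<omega> + c *\<^sub>R V \<omega>)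
    = distr (distr M borel X \<Otimes>\<^sub>M distr M borel V) borel (\<lambda>(x, w). x + c *\<^sub>R w)"
proof -
  interpret prob_space M by fact
  have X': "X \<in> borel_measurable M" using X G by (rule measurable_from_subalg[rotated])
  note [measurable] = X' V
  have "indep_var borel X borel V"
    unfolding indep_var_eq indep_set_def
  proof (intro conjI X' V)
    have space_G: "space G = space M" using G by (simp add: subalgebra_def)
    have 1: "sigma_sets (space M) {X -` B \<inter> space M |B. B \<in> sets borel} \<subseteq> sets G"
      unfolding space_G[symmetric] using X by (intro sets.sigma_sets_subset) (auto intro: measurable_sets)
    have 2: "sigma_sets (space M) {V -` B \<inter> space M |B. B \<in> sets borel} \<subseteq> sets (vimage_algebra (space M) V borel)"
      by (simp add: sets_vimage_algebra)
    show "indep_sets (case_bool (sigma_sets (space M) {X -` B \<inter> space M |B. B \<in> sets borel})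
        (sigma_sets (space M) {V -` B \<inter> space M |B. B \<in> sets borel})) UNIV"
      using indep[unfolded indep_set_def] 1 2
      by (rule_tac indep_sets_mono_sets) (auto split: bool.split)
  qed
  then have "distr M borel X \<Otimes>\<^sub>M distr M borel V = distr M (borel \<Otimes>\<^sub>M borel) (\<lambda>\<omega>. (X \<omega>, V \<omega>))"
    by (simp add: indep_var_distribution_eq)
  moreover have "(\<lambda>(x, w). x + c *\<^sub>R w) \<in> borel_measurable ((borel :: 'a measure) \<Otimes>\<^sub>M borel)"
    by measurable
  ultimately show ?thesis
    by (simp add: distr_distr comp_def)
qed

lemma block_law_process_add_increment:
  assumes M: "prob_space M" and G: "subalgebra M G" and G': "subalgebra M G'" and GG': "sets G \<subseteq> sets G'"
    and P: "borel_partition J A"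
    and Y: "block_law_process M G J A Y" and V: "V \<in> borel_measurable G'"
    and indep: "prob_space.indep_set M (sets G) (sets (vimage_algebra (space M) V borel))"
  shows "block_law_process M G' J A (\<lambda>u \<omega>. Y u \<omega> + c *\<^sub>R V \<omega>)"
proof -
  have V': "V \<in> borel_measurable M" using V G' by (rule measurable_from_subalg[rotated])
  have Y2: "(\<lambda>(u, \<omega>). Y u \<omega>) \<in> borel_measurable (unit_borel \<Otimes>\<^sub>M M)"
    and Y1: "\<And>u. u \<in> {0..1} \<Longrightarrow> Y u \<in> borel_measurable G"
    using block_law_processD[OF Y] .
  obtain Z where Z: "Z \<in> null_sets lborel" "\<And>j u v. j \<in> J \<Longrightarrow> u \<in> A j - Z \<Longrightarrow> v \<in> A j - Z \<Longrightarrow> distr M borel (Y u) = distr M borel (Y v)"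
    using block_law_processE[OF Y] by blast
  have GG: "subalgebra G' G" using G G' GG' by (simp add: subalgebra_def)
  have "(\<lambda>z. (case z of (u, \<omega>) \<Rightarrow> Y u \<omega>) + c *\<^sub>R V (snd z)) \<in> borel_measurable (unit_borel \<Otimes>\<^sub>M M)"
    using measurable_compose[OF measurable_snd V'] by (intro borel_measurable_add Y2 borel_measurable_scaleR) auto
  then have "(\<lambda>(u, \<omega>). Y u \<omega> + c *\<^sub>R V \<omega>) \<in> borel_measurable (unit_borel \<Otimes>\<^sub>M M)"
    by (simp add: case_prod_beta')
  moreover have "(\<lambda>\<omega>. Y u \<omega> + c *\<^sub>R V \<omega>) \<in> borel_measurable G'" if "u \<in> {0..1}" for u
    using measurable_from_subalg[OF GG Y1[OF that]] V by simp
  moreover have "distr M borel (\<lambda>\<omega>. Y u \<omega> + c *\<^sub>R V \<omega>) = distr M borel (\<lambda>\<omega>. Y v \<omega> + c *\<^sub>R V \<omega>)"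
    if "j \<in> J" "u \<in> A j - Z" "v \<in> A j - Z" for j u v
  proof -
    have uv: "u \<in> {0..1}" "v \<in> {0..1}" using that borel_partition_label[OF P] by blast+
    show ?thesis
      unfolding distr_add_indep_increment[OF M G Y1[OF uv(1)] V' indep] distr_add_indep_increment[OF M G Y1[OF uv(2)] V' indep]
      using Z(2)[OF that] by simp
  qed
  ultimately show ?thesis using Z(1) by (intro block_law_processI)
qed

text \<open>The maps of two labels of a block only have to agree almost everywhere, because the
  laws they are applied to have a density.\<close>

lemma block_law_process_map:
  fixes Y :: "real \<Rightarrow> 'w \<Rightarrow> 'a::euclidean_space" and f :: "real \<Rightarrow> 'a \<Rightarrow> 'b::euclidean_space"
  assumes G: "subalgebra M G" and P: "borel_partition J A"
    and Y: "block_law_process M G J A Y"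
    and f: "(\<lambda>(u, x). f u x) \<in> borel_measurable (unit_borel \<Otimes>\<^sub>M borel)"
    and law: "\<And>u. u \<in> {0..1} \<Longrightarrow> distr M borel (Y u) = density lborel (\<rho> u)" "\<And>u. u \<in> {0..1} \<Longrightarrow> \<rho> u \<in> borel_measurable borel"
    and Z': "Z' \<in> null_sets lborel" "\<And>j u v. j \<in> J \<Longrightarrow> u \<in> A j - Z' \<Longrightarrow> v \<in> A j - Z' \<Longrightarrow> AE x in lborel. f u x = f v x"
  shows "block_law_process M G J A (\<lambda>u \<omega>. f u (Y u \<omega>))"
proof -
  have Y2: "(\<lambda>(u, \<omega>). Y u \<omega>) \<in> borel_measurable (unit_borel \<Otimes>\<^sub>M M)"
    and Y1: "\<And>u. u \<in> {0..1} \<Longrightarrow> Y u \<in> borel_measurable G"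
    using block_law_processD[OF Y] .
  obtain Z where Z: "Z \<in> null_sets lborel" "\<And>j u v. j \<in> J \<Longrightarrow> u \<in> A j - Z \<Longrightarrow> v \<in> A j - Z \<Longrightarrow> distr M borel (Y u) = distr M borel (Y v)"
    using block_law_processE[OF Y] by blast
  have f1: "f u \<in> borel_measurable borel" if "u \<in> {0..1}" for u
    using measurable_compose[OF measurable_Pair1' f, of u] that by (simp add: space_restrict_space)
  have Y1M: "Y u \<in> borel_measurable M" if "u \<in> {0..1}" for u
    using measurable_from_subalg[OF G Y1[OF that]] .
  have "(\<lambda>z. (fst z, case z of (u, \<omega>) \<Rightarrow> Y u \<omega>)) \<in> measurable (unit_borel \<Otimes>\<^sub>M M) (unit_borel \<Otimes>\<^sub>M borel)"
    by (intro measurable_Pair measurable_fst Y2)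
  from measurable_compose[OF this f]
  have "(\<lambda>(u, \<omega>). f u (Y u \<omega>)) \<in> borel_measurable (unit_borel \<Otimes>\<^sub>M M)"
    by (simp add: case_prod_beta')
  moreover have "(\<lambda>\<omega>. f u (Y u \<omega>)) \<in> borel_measurable G" if "u \<in> {0..1}" for u
    using measurable_compose[OF Y1[OF that] f1[OF that]] .
  moreover have "distr M borel (\<lambda>\<omega>. f u (Y u \<omega>)) = distr M borel (\<lambda>\<omega>. f v (Y v \<omega>))"
    if uv: "j \<in> J" "u \<in> A j - (Z \<union> Z')" "v \<in> A j - (Z \<union> Z')" for j u v
  proof -
    have I: "u \<in> {0..1}" "v \<in> {0..1}" using uv borel_partition_label[OF P] by blast+
    have push: "distr M borel (\<lambda>\<omega>. f w (Y w \<omega>)) = distr (distr M borel (Y w)) borel (f w)" if "w \<in> {0..1}" for w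
      using distr_distr[OF f1[OF that] Y1M[OF that]] by (simp add: comp_def)
    have "AE x in density lborel (\<rho> v). f u x = f v x"
      using Z'(2)[OF uv(1), of u v] uv law(2)[OF I(2)] by (subst AE_density) auto
    then have "distr (distr M borel (Y v)) borel (f u) = distr (distr M borel (Y v)) borel (f v)"
      unfolding law(1)[OF I(2)] using f1[OF I(1)] f1[OF I(2)] by (intro distr_cong_AE) auto
    moreover have "distr M borel (Y u) = distr M borel (Y v)" using Z(2)[OF uv(1)] uv by auto
    ultimately show ?thesis unfolding push[OF I(1)] push[OF I(2)] by simp
  qed
  moreover have "Z \<union> Z' \<in> null_sets lborel" using Z(1) Z'(1) by (rule null_sets.Un)
  ultimately show ?thesis by (intro block_law_processI)
qed

text \<open>Extending \<open>b\<close> by \<open>0\<close> outside its domain does not change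
  the integral, as \<open>{s..t}\<close> lies in \<open>{0..T}\<close>.\<close>

lemma borel_measurable_drift_integral:
  fixes b :: "real \<Rightarrow> real^'d \<Rightarrow> real \<Rightarrow> real^'d"
  assumes b: "(\<lambda>(t, x, r). b t x r) \<in> borel_measurable (restrict_space borel ({0..T} \<times> UNIV \<times> UNIV))"
    and st: "0 \<le> s" "t \<le> T"
  shows "(\<lambda>(x, r). LINT \<tau>:{s..t}|lborel. b \<tau> x r) \<in> borel_measurable (borel \<Otimes>\<^sub>M borel)"
proof -
  let ?S = "{0..T} \<times> (UNIV :: (real^'d) set) \<times> (UNIV :: real set)"
  define b' where "b' z = indicator ?S z *\<^sub>R (case z of (t, x, r) \<Rightarrow> b t x r)" for z
  have "?S \<in> sets borel" by (intro borel_closed closed_Times) auto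
  then have b': "b' \<in> borel_measurable borel"
    using b unfolding b'_def by (subst (asm) borel_measurable_restrict_space_iff) auto
  have "(\<lambda>z. (snd z, fst (fst z), snd (fst z))) \<in> measurable (((borel :: (real^'d) measure) \<Otimes>\<^sub>M (borel :: real measure)) \<Otimes>\<^sub>M lborel) borel"
    unfolding borel_prod[symmetric] by measurable
  from measurable_compose[OF this b']
  have [measurable]: "(\<lambda>z. b' (snd z, fst (fst z), snd (fst z))) \<in> borel_measurable ((borel \<Otimes>\<^sub>M borel) \<Otimes>\<^sub>M lborel)" .
  have "(\<lambda>z. LINT \<tau>|lborel. indicator {s..t} \<tau> *\<^sub>R b' (\<tau>, fst z, snd z)) \<in> borel_measurable (borel \<Otimes>\<^sub>M borel)"
    by measurable
  moreover have "(LINT \<tau>|lborel. indicator {s..t} \<tau> *\<^sub>R b' (\<tau>, x, r)) = (LINT \<tau>:{s..t}|lborel. b \<tau> x r)" for x r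
    unfolding set_lebesgue_integral_def using st
    by (intro Bochner_Integration.integral_cong) (auto simp: b'_def indicator_def)
  ultimately show ?thesis by (simp only: case_prod_beta')
qed

text \<open>The step is the deterministic map \<open>f u\<close>, which adds the drift, followed
  by an independent increment. For almost all labels \<open>f u\<close> agrees almost everywhere
  with a map that involves \<open>u\<close> only through \<open>K u\<close>.\<close>

lemma block_law_process_euler_step:
  fixes Y :: "real \<Rightarrow> 'w \<Rightarrow> real^'d" and b :: "real \<Rightarrow> real^'d \<Rightarrow> real \<Rightarrow> real^'d" and s t T c :: real
  assumes M: "prob_space M" and G: "subalgebra M G" and G': "subalgebra M G'" and GG': "sets G \<subseteq> sets G'"
    and P: "borel_partition J A" and K: "block_constant J A K" "\<And>u. u \<in> {0..1} \<Longrightarrow> K u \<in> unit_measures"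
    and bdd: "bounded_on_L1 K"
    and b: "(\<lambda>(t, x, r). b t x r) \<in> borel_measurable (restrict_space borel ({0..T} \<times> UNIV \<times> UNIV))"
    and st: "0 \<le> s" "t \<le> T"
    and Y: "block_law_process M G J A Y"
    and \<rho>: "\<And>u. u \<in> {0..1} \<Longrightarrow> continuous_on UNIV (\<lambda>x. \<rho> x u)" "\<And>u x. u \<in> {0..1} \<Longrightarrow> 0 \<le> \<rho> x u"
    and law: "\<And>u. u \<in> {0..1} \<Longrightarrow> distr M borel (Y u) = density lborel (\<lambda>x. ennreal (\<rho> x u))"
    and V: "V \<in> borel_measurable G'"
    and indep: "prob_space.indep_set M (sets G) (sets (vimage_algebra (space M) V borel))"
  shows "block_law_process M G' J A (\<lambda>u \<omega>. Y u \<omega>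
    + (LINT \<tau>:{s..t}|lborel. b \<tau> (Y u \<omega>) (interaction K \<rho> u (Y u \<omega>))) + c *\<^sub>R V \<omega>)"
proof -
  interpret prob_space M by fact
  define f where "f u x = x + (LINT \<tau>:{s..t}|lborel. b \<tau> x (interaction K \<rho> u x))" for u x
  have Y1: "Y u \<in> borel_measurable M" if "u \<in> {0..1}" for u
    using measurable_from_subalg[OF G block_law_processD(2)[OF Y that]] .
  have \<rho>2: "(\<lambda>(x, v). \<rho> x v) \<in> borel_measurable (borel \<Otimes>\<^sub>M unit_borel)"
    by (intro borel_measurable_joint_density[OF M block_law_processD(1)[OF Y] Y1 \<rho> law])
  have \<rho>1: "(\<lambda>x. ennreal (\<rho> x u)) \<in> borel_measurable borel" if "u \<in> {0..1}" for u
    using borel_measurable_continuous_onI[OF \<rho>(1)[OF that]] by simp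
  have one: "(\<integral>\<^sup>+x. ennreal (\<rho> x u) \<partial>lborel) = 1" if "u \<in> {0..1}" for u
  proof -
    interpret D: prob_space "distr M borel (Y u)" by (intro prob_space_distr Y1 that)
    show ?thesis using D.emeasure_space_1 \<rho>1[OF that] by (simp add: law[OF that] emeasure_density)
  qed
  have "AE u in lborel. u \<in> {0..1} \<longrightarrow> (AE x in lborel. interaction K \<rho> u x = (LINT v|K u. \<rho> x v))"
    using \<rho>(2) one by (intro AE_interaction_eq[OF P K bdd \<rho>2])
  then obtain Z where Z: "Z \<in> null_sets lborel"
    "\<And>u. u \<in> {0..1} - Z \<Longrightarrow> AE x in lborel. interaction K \<rho> u x = (LINT v|K u. \<rho> x v)"
    by (rule AE_E3) auto
  have f: "(\<lambda>(u, x). f u x) \<in> borel_measurable (unit_borel \<Otimes>\<^sub>M borel)"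
  proof -
    have "(\<lambda>z. (snd z, case z of (u, x) \<Rightarrow> interaction K \<rho> u x)) \<in> measurable (unit_borel \<Otimes>\<^sub>M borel) (borel \<Otimes>\<^sub>M borel)"
      by (intro measurable_Pair measurable_snd borel_measurable_interaction[OF P K \<rho>2])
    from measurable_compose[OF this borel_measurable_drift_integral[OF b st]]
    have "(\<lambda>z. snd z + (LINT \<tau>:{s..t}|lborel. b \<tau> (snd z) (interaction K \<rho> (fst z) (snd z))))
        \<in> borel_measurable (unit_borel \<Otimes>\<^sub>M borel)"
      by (intro borel_measurable_add measurable_snd) (simp add: case_prod_beta')
    then show ?thesis by (simp add: f_def case_prod_beta')
  qed
  have "AE x in lborel. f u x = f v x" if "j \<in> J" "u \<in> A j - Z" "v \<in> A j - Z" for j u v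
  proof -
    have uv: "u \<in> {0..1} - Z" "v \<in> {0..1} - Z" using that borel_partition_label[OF P] by blast+
    have K_eq: "K u = K v" using K(1) that unfolding block_constant_def by blast
    from Z(2)[OF uv(1)] Z(2)[OF uv(2)] show ?thesis
      by eventually_elim (simp add: f_def K_eq)
  qed
  then have "block_law_process M G J A (\<lambda>u \<omega>. f u (Y u \<omega>))"
    by (intro block_law_process_map[OF G P Y f law \<rho>1 Z(1)])
  from block_law_process_add_increment[OF M G G' GG' P this V indep, of c]
  show ?thesis by (simp add: f_def)
qed

text \<open>Induction over the grid, each step covering a half-open interval between grid
  points. The first step has no drift, so densities are needed at positive grid points only. The
  process starts at \<open>X\<^sub>0 u + sqrt 2 *\<^sub>R W 0\<close>, which has the law of
  \<open>X\<^sub>0 u\<close> since \<open>W 0\<close> vanishes almost surely, though possibly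
  not everywhere.\<close>

lemma euler_scheme_block_law:
  fixes X :: "real \<Rightarrow> real \<Rightarrow> 'w \<Rightarrow> real^'d"
  assumes T: "0 < T" and N: "1 \<le> N"
    and P: "borel_partition J A" and K: "block_constant J A K" "\<And>u. u \<in> {0..1} \<Longrightarrow> K u \<in> unit_measures"
    and bdd: "bounded_on_L1 K"
    and b: "(\<lambda>(t, x, r). b t x r) \<in> borel_measurable (restrict_space borel ({0..T} \<times> UNIV \<times> UNIV))"
    and basis: "usual_filtered_space M F" "wiener_process M F W"
    and X\<^sub>0: "block_law_process M (F 0) J A X\<^sub>0"
    and euler: "euler_scheme M W X\<^sub>0 T b K N X q"
    and t: "0 < t" "t \<le> T"
  shows "block_law_process M (F t) J A (X t)"
proof -
  define h where "h = T / real N"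
  have h: "0 < h" "real N * h = T" using T N by (auto simp: h_def)
  have M: "prob_space M" and F: "\<And>t. 0 \<le> t \<Longrightarrow> subalgebra M (F t)"
    and F_mono: "\<And>s t. 0 \<le> s \<Longrightarrow> s \<le> t \<Longrightarrow> sets (F s) \<subseteq> sets (F t)"
    using basis(1) unfolding usual_filtered_space_def by blast+
  interpret prob_space M by fact
  have W: "\<And>t. 0 \<le> t \<Longrightarrow> W t \<in> borel_measurable (F t)" and W0: "AE \<omega> in M. W 0 \<omega> = 0"
    and indep: "\<And>s t. 0 \<le> s \<Longrightarrow> s < t \<Longrightarrow> indep_set (sets (F s)) (sets (vimage_algebra (space M) (\<lambda>\<omega>. W t \<omega> - W s \<omega>) borel))"
    using basis(2) unfolding wiener_process_def by blast+
  have incr: "(\<lambda>\<omega>. W t \<omega> - W s \<omega>) \<in> borel_measurable (F t)" if "0 \<le> s" "s \<le> t" for s t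
  proof -
    have "subalgebra (F t) (F s)" using F[of s] F[of t] F_mono[of s t] that by (simp add: subalgebra_def)
    then have "W s \<in> borel_measurable (F t)" using W[OF that(1)] by (rule measurable_from_subalg)
    then show ?thesis using W[of t] that by (intro borel_measurable_diff) auto
  qed
  have X_init: "X t u \<omega> = X\<^sub>0 u \<omega> + sqrt 2 *\<^sub>R W t \<omega>" if "u \<in> {0..1}" "\<omega> \<in> space M" "0 \<le> t" "t \<le> h" for t u \<omega>
    using euler that unfolding euler_scheme_def Let_def h_def[symmetric] by (auto simp only: atLeastAtMost_iff)
  have X_step: "X t u \<omega> = X (real k * h) u \<omega>
             + (LINT s:{real k * h..t}|lborel. b s (X (real k * h) u \<omega>)
                    (interaction K (q (real k * h)) u (X (real k * h) u \<omega>)))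
             + sqrt 2 *\<^sub>R (W t \<omega> - W (real k * h) \<omega>)"
    if "u \<in> {0..1}" "\<omega> \<in> space M" "1 \<le> k" "k < N" "real k * h \<le> t" "t \<le> real (k + 1) * h" for t u \<omega> k
  proof -
    have "k \<in> {1..<N}" "t \<in> {real k * h..real (k + 1) * h}" using that by auto
    then show ?thesis
      using euler that(1,2) unfolding euler_scheme_def Let_def h_def[symmetric] by blast
  qed
  have q: "continuous_on UNIV (\<lambda>x. q t x u)" "0 \<le> q t x u"
      "distr M borel (X t u) = density lborel (\<lambda>x. ennreal (q t x u))"
    if "0 < t" "t \<le> T" "u \<in> {0..1}" for t u x
  proof -
    have "t \<in> {0<..T}" using that by simp
    then show "continuous_on UNIV (\<lambda>x. q t x u)" "0 \<le> q t x u"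
        "distr M borel (X t u) = density lborel (\<lambda>x. ennreal (q t x u))"
      using euler that(3) unfolding euler_scheme_def Let_def by blast+
  qed
  have "block_law_process M (F t) J A (X t)" if "k \<le> N" "0 < t" "t \<le> real k * h" for k t
    using that
  proof (induction k arbitrary: t)
    case (Suc k)
    have "real (Suc k) * h \<le> real N * h" using Suc.prems(1) h(1) by (intro mult_right_mono) auto
    then have "t \<le> T" using Suc.prems h by linarith
    consider "t \<le> real k * h" | "k = 0" | "1 \<le> k" "real k * h < t" by linarith
    then show ?case
    proof cases
      case 1
      then show ?thesis using Suc by simp
    next
      case 2
      have sub0: "subalgebra M (F 0)" by (rule F) simp
      have X0M: "X\<^sub>0 u \<in> borel_measurable M" if "u \<in> {0..1}" for u
        using measurable_from_subalg[OF sub0 block_law_processD(2)[OF X\<^sub>0 that]] .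
      have W0M: "W 0 \<in> borel_measurable M" using measurable_from_subalg[OF sub0 W] by simp
      have start: "block_law_process M (F 0) J A (\<lambda>u \<omega>. X\<^sub>0 u \<omega> + sqrt 2 *\<^sub>R W 0 \<omega>)"
      proof -
        have "(\<lambda>z. (case z of (u, \<omega>) \<Rightarrow> X\<^sub>0 u \<omega>) + sqrt 2 *\<^sub>R W 0 (snd z)) \<in> borel_measurable (unit_borel \<Otimes>\<^sub>M M)"
          using measurable_compose[OF measurable_snd W0M]
          by (intro borel_measurable_add borel_measurable_scaleR block_law_processD(1)[OF X\<^sub>0]) auto
        then have joint: "(\<lambda>(u, \<omega>). X\<^sub>0 u \<omega> + sqrt 2 *\<^sub>R W 0 \<omega>) \<in> borel_measurable (unit_borel \<Otimes>\<^sub>M M)"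
          by (simp add: case_prod_beta')
        have adapted: "(\<lambda>\<omega>. X\<^sub>0 u \<omega> + sqrt 2 *\<^sub>R W 0 \<omega>) \<in> borel_measurable (F 0)" if "u \<in> {0..1}" for u
          using block_law_processD(2)[OF X\<^sub>0 that] W[of 0] by simp
        have eq: "distr M borel (\<lambda>\<omega>. X\<^sub>0 u \<omega> + sqrt 2 *\<^sub>R W 0 \<omega>) = distr M borel (X\<^sub>0 u)" if "u \<in> {0..1}" for u
        proof (intro distr_cong_AE)
          show "AE \<omega> in M. X\<^sub>0 u \<omega> + sqrt 2 *\<^sub>R W 0 \<omega> = X\<^sub>0 u \<omega>" using W0 by eventually_elim simp
        qed (use X0M[OF that] W0M in auto)
        obtain Z where Z: "Z \<in> null_sets lborel" "\<And>j u v. j \<in> J \<Longrightarrow> u \<in> A j - Z \<Longrightarrow> v \<in> A j - Z \<Longrightarrow> distr M borel (X\<^sub>0 u) = distr M borel (X\<^sub>0 v)"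
          using block_law_processE[OF X\<^sub>0] by blast
        show ?thesis
        proof (rule block_law_processI[OF joint adapted Z(1)])
          fix j u v assume uv: "j \<in> J" "u \<in> A j - Z" "v \<in> A j - Z"
          then have "u \<in> {0..1}" "v \<in> {0..1}" using borel_partition_label[OF P] by blast+
          then show "distr M borel (\<lambda>\<omega>. X\<^sub>0 u \<omega> + sqrt 2 *\<^sub>R W 0 \<omega>) = distr M borel (\<lambda>\<omega>. X\<^sub>0 v \<omega> + sqrt 2 *\<^sub>R W 0 \<omega>)"
            using Z(2)[OF uv] by (simp add: eq)
        qed
      qed
      have "block_law_process M (F t) J A (\<lambda>u \<omega>. (X\<^sub>0 u \<omega> + sqrt 2 *\<^sub>R W 0 \<omega>) + sqrt 2 *\<^sub>R (W t \<omega> - W 0 \<omega>))"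
        using Suc.prems(2) by (intro block_law_process_add_increment[OF M sub0 _ _ P start] F F_mono incr indep) auto
      then show ?thesis
      proof (rule block_law_process_cong[OF _ _ P])
        show "subalgebra M (F t)" using Suc.prems(2) by (intro F) simp
        show "X t u \<omega> = (X\<^sub>0 u \<omega> + sqrt 2 *\<^sub>R W 0 \<omega>) + sqrt 2 *\<^sub>R (W t \<omega> - W 0 \<omega>)"
          if "u \<in> {0..1}" "\<omega> \<in> space M" for u \<omega>
          using X_init[OF that, of t] Suc.prems 2 by (simp add: scaleR_diff_right)
      qed
    next
      case 3
      define s where "s = real k * h"
      have s: "0 < s" "s < t" "s \<le> T" using 3 h(1) \<open>t \<le> T\<close> by (auto simp: s_def)
      have IH: "block_law_process M (F s) J A (X s)"
        using Suc.IH[of s] Suc.prems(1) s by (simp add: s_def)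
      have "block_law_process M (F t) J A (\<lambda>u \<omega>. X s u \<omega>
          + (LINT \<tau>:{s..t}|lborel. b \<tau> (X s u \<omega>) (interaction K (q s) u (X s u \<omega>))) + sqrt 2 *\<^sub>R (W t \<omega> - W s \<omega>))"
        using s \<open>t \<le> T\<close>
        by (intro block_law_process_euler_step[OF M _ _ _ P K bdd b _ _ IH] q F F_mono incr indep) auto
      then show ?thesis
      proof (rule block_law_process_cong[OF _ _ P])
        show "subalgebra M (F t)" using Suc.prems(2) by (intro F) simp
        show "X t u \<omega> = X s u \<omega>
          + (LINT \<tau>:{s..t}|lborel. b \<tau> (X s u \<omega>) (interaction K (q s) u (X s u \<omega>))) + sqrt 2 *\<^sub>R (W t \<omega> - W s \<omega>)"
          if "u \<in> {0..1}" "\<omega> \<in> space M" for u \<omega>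
          unfolding s_def using Suc.prems 3 by (intro X_step that) auto
      qed
    qed
  qed simp
  from this[of N t] show ?thesis using t h by simp
qed

lemma block_law_process_density_constant:
  fixes Y :: "real \<Rightarrow> 'w \<Rightarrow> 'a::euclidean_space"
  assumes M: "prob_space M" and G: "subalgebra M G" and P: "borel_partition J A"
    and Y: "block_law_process M G J A Y"
    and \<rho>: "\<And>u. u \<in> {0..1} \<Longrightarrow> continuous_on UNIV (\<lambda>x. \<rho> x u)" "\<And>u x. u \<in> {0..1} \<Longrightarrow> 0 \<le> \<rho> x u"
    and law: "\<And>u. u \<in> {0..1} \<Longrightarrow> distr M borel (Y u) = density lborel (\<lambda>x. ennreal (\<rho> x u))"
    and j: "j \<in> J"
  shows "\<exists>c. AE u in restrict_space lborel (A j). \<rho> x u = c"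
proof -
  interpret prob_space M by fact
  obtain Z where Z: "Z \<in> null_sets lborel"
    "\<And>j u v. j \<in> J \<Longrightarrow> u \<in> A j - Z \<Longrightarrow> v \<in> A j - Z \<Longrightarrow> distr M borel (Y u) = distr M borel (Y v)"
    using block_law_processE[OF Y] by blast
  have "\<exists>c. \<forall>u\<in>A j - Z. \<rho> x u = c"
  proof (cases "A j - Z = {}")
    case False
    then obtain a where a: "a \<in> A j - Z" by blast
    have "\<rho> x u = \<rho> x a" if u: "u \<in> A j - Z" for u
    proof -
      have I: "u \<in> {0..1}" "a \<in> {0..1}" using u a j borel_partition_label[OF P] by blast+
      have "finite_measure (distr M borel (Y u))"
        by (intro finite_measure_distr measurable_from_subalg[OF G block_law_processD(2)[OF Y I(1)]])
      moreover have "distr M borel (Y u) = density lborel (\<lambda>x. ennreal (\<rho> x a))"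
        using Z(2)[OF j u a] law[OF I(2)] by simp
      ultimately have "(\<lambda>x. \<rho> x u) = (\<lambda>x. \<rho> x a)"
        using \<rho> I law[OF I(1)] by (intro continuous_density_unique[of _ _ "distr M borel (Y u)"])
      then show ?thesis by (rule fun_cong)
    qed
    then show ?thesis by blast
  qed blast
  then obtain c where c: "\<And>u. u \<in> A j - Z \<Longrightarrow> \<rho> x u = c" by blast
  have "AE u in lborel. u \<notin> Z" using Z(1) by (rule AE_not_in)
  then have "AE u in lborel. u \<in> A j \<longrightarrow> \<rho> x u = c"
    by eventually_elim (use c in blast)
  moreover have "A j \<in> sets borel" using P j by (simp add: borel_partition_def)
  ultimately show ?thesis by (auto simp: AE_restrict_space_iff)
qed

section \<open>Passage to the limit\<close>

text \<open>The double integral of \<open>|f u - f v|\<close> is at most \<open>2 * R(space) *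
  \<integral>|c - f|\<close> for every constant \<open>c\<close>, hence vanishes in the limit;
  any \<open>f a\<close> with vanishing inner integral then serves as the constant.\<close>

lemma AE_constant_L1_limit:
  fixes f :: "'a \<Rightarrow> real" and g :: "nat \<Rightarrow> 'a \<Rightarrow> real"
  assumes R: "finite_measure R" and f[measurable]: "f \<in> borel_measurable R"
    and g: "\<And>k. \<exists>c. AE u in R. g k u = c"
    and lim: "(\<lambda>k. \<integral>\<^sup>+u. ennreal \<bar>g k u - f u\<bar> \<partial>R) \<longlonglongrightarrow> 0"
  shows "\<exists>c. AE u in R. f u = c"
proof (cases "AE u in R. False")
  case False
  interpret finite_measure R by fact
  let ?I = "\<integral>\<^sup>+u. \<integral>\<^sup>+v. ennreal \<bar>f u - f v\<bar> \<partial>R \<partial>R"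
  let ?m = "emeasure R (space R)"
  define d where "d k = (\<integral>\<^sup>+u. ennreal \<bar>g k u - f u\<bar> \<partial>R)" for k
  have "?I \<le> 2 * ?m * d k" for k
  proof -
    obtain c where c: "AE u in R. g k u = c" using g by blast
    have dc: "d k = (\<integral>\<^sup>+u. ennreal \<bar>c - f u\<bar> \<partial>R)"
      unfolding d_def by (intro nn_integral_cong_AE) (use c in \<open>eventually_elim, simp\<close>)
    have "?I \<le> (\<integral>\<^sup>+u. \<integral>\<^sup>+v. ennreal \<bar>c - f u\<bar> + ennreal \<bar>c - f v\<bar> \<partial>R \<partial>R)"
      by (intro nn_integral_mono) (auto simp flip: ennreal_plus intro!: ennreal_leI)
    also have "\<dots> = (\<integral>\<^sup>+u. ennreal \<bar>c - f u\<bar> * ?m + d k \<partial>R)"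
      by (simp add: nn_integral_add dc)
    also have "\<dots> = 2 * ?m * d k"
      by (simp add: nn_integral_add nn_integral_multc flip: dc) (simp add: mult.commute mult_2 distrib_left)
    finally show ?thesis .
  qed
  moreover have "(\<lambda>k. 2 * ?m * d k) \<longlonglongrightarrow> 2 * ?m * 0"
    using lim unfolding d_def
    by (intro ennreal_tendsto_cmult) (auto simp: less_top[symmetric] ennreal_mult_eq_top_iff)
  ultimately have "?I \<le> 2 * ?m * 0" by (intro LIMSEQ_le_const) auto
  then have "?I = 0" by simp
  then have "AE u in R. (\<integral>\<^sup>+v. ennreal \<bar>f u - f v\<bar> \<partial>R) = 0"
    by (subst (asm) nn_integral_0_iff_AE) auto
  then have "\<exists>a. (\<integral>\<^sup>+v. ennreal \<bar>f a - f v\<bar> \<partial>R) = 0"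
  proof (rule contrapos_pp)
    assume "\<nexists>a. (\<integral>\<^sup>+v. ennreal \<bar>f a - f v\<bar> \<partial>R) = 0"
    then show "\<not> (AE u in R. (\<integral>\<^sup>+v. ennreal \<bar>f u - f v\<bar> \<partial>R) = 0)" using False by simp
  qed
  then obtain a where a: "(\<integral>\<^sup>+v. ennreal \<bar>f a - f v\<bar> \<partial>R) = 0" by blast
  then have "AE v in R. ennreal \<bar>f a - f v\<bar> = 0" by (subst (asm) nn_integral_0_iff_AE) auto
  then have "AE v in R. f v = f a" by eventually_elim (simp add: ennreal_eq_0_iff)
  then show ?thesis by blast
qed (auto elim: eventually_mono)

lemma L1_continuous_on_subset_domain:
  assumes f: "L1_continuous_on S (restrict_space lborel B) f"
    and A: "A \<in> sets borel" and B: "B \<in> sets borel" and AB: "A \<subseteq> B"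
  shows "L1_continuous_on S (restrict_space lborel A) f"
proof -
  have sub: "integrable (restrict_space lborel A) g \<and>
      (LINT u|restrict_space lborel A. \<bar>g u\<bar>) \<le> (LINT u|restrict_space lborel B. \<bar>g u\<bar>)"
    if "integrable (restrict_space lborel B) g" for g :: "'b \<Rightarrow> real"
  proof -
    have gB: "integrable lborel (\<lambda>u. indicator B u *\<^sub>R g u)"
      using that B by (simp add: integrable_restrict_space)
    have "integrable lborel (\<lambda>u. indicator A u *\<^sub>R (indicator B u *\<^sub>R g u))"
      using A by (intro integrable_mult_indicator[OF _ gB]) simp
    also have "(\<lambda>u. indicator A u *\<^sub>R (indicator B u *\<^sub>R g u)) = (\<lambda>u. indicator A u *\<^sub>R g u)"
      using AB by (auto simp: fun_eq_iff indicator_def)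
    finally have gA: "integrable lborel (\<lambda>u. indicator A u *\<^sub>R g u)" .
    have "(LINT u|lborel. \<bar>indicator A u *\<^sub>R g u\<bar>) \<le> (LINT u|lborel. \<bar>indicator B u *\<^sub>R g u\<bar>)"
      using gA gB AB by (intro integral_mono) (auto simp: indicator_def)
    then show ?thesis
      using gA A B by (simp add: integrable_restrict_space integral_restrict_space abs_mult)
  qed
  show ?thesis
    unfolding L1_continuous_on_def
  proof (intro conjI ballI)
    fix z assume z: "z \<in> S"
    show "integrable (restrict_space lborel A) (f z)" using f z sub unfolding L1_continuous_on_def by blast
    have lim: "((\<lambda>z'. LINT u|restrict_space lborel B. \<bar>f z' u - f z u\<bar>) \<longlongrightarrow> 0) (at z within S)"
      using f z unfolding L1_continuous_on_def by blast
    have upper: "\<forall>\<^sub>F z' in at z within S. (LINT u|restrict_space lborel A. \<bar>f z' u - f z u\<bar>)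
        \<le> (LINT u|restrict_space lborel B. \<bar>f z' u - f z u\<bar>)"
      unfolding eventually_at_filter
    proof (intro always_eventually allI impI)
      fix z' assume "z' \<in> S"
      then have "integrable (restrict_space lborel B) (\<lambda>u. f z' u - f z u)"
        using f z unfolding L1_continuous_on_def by (intro Bochner_Integration.integrable_diff) blast+
      from sub[OF this] show "(LINT u|restrict_space lborel A. \<bar>f z' u - f z u\<bar>)
        \<le> (LINT u|restrict_space lborel B. \<bar>f z' u - f z u\<bar>)" by blast
    qed
    show "((\<lambda>z'. LINT u|restrict_space lborel A. \<bar>f z' u - f z u\<bar>) \<longlongrightarrow> 0) (at z within S)"
      by (rule tendsto_sandwich[OF _ upper tendsto_const lim]) (auto intro!: always_eventually integral_nonneg_AE)
  qed
qed

text \<open>Every \<open>(t, y)\<close> with \<open>t > 0\<close> lies in one of the compact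
  sets on which convergence is uniform.\<close>

lemma euler_limit_pointwise:
  assumes lim: "locally_uniform_euler_limit T q p" and t: "0 < t" "t \<le> T"
  shows "\<exists>r :: nat \<Rightarrow> nat. (\<forall>k. 1 \<le> r k) \<and>
    (\<lambda>k. \<integral>\<^sup>+u. ennreal \<bar>q (r k) t y u - p t y u\<bar> \<partial>unit_lborel) \<longlonglongrightarrow> 0"
proof -
  obtain r :: "nat \<Rightarrow> nat" where r: "\<And>k. 1 \<le> r k"
    and R: "\<And>m::nat. real m > 1 / T \<Longrightarrow> (\<lambda>k. SUP y\<in>cball 0 (real m). SUP t\<in>{1 / real m..T}.
              \<integral>\<^sup>+u. ennreal \<bar>q (r k) t y u - p t y u\<bar> \<partial>unit_lborel) \<longlonglongrightarrow> 0"
    using lim unfolding locally_uniform_euler_limit_def by blast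
  obtain m :: nat where m: "max (1 / T) (max (1 / t) (norm y)) < real m" using reals_Archimedean2 by blast
  have "1 / real m \<le> t"
  proof -
    have "0 < 1 / t" using t by simp
    then have "0 < real m" "1 / t < real m" using m by linarith+
    then show ?thesis using t by (simp add: field_simps)
  qed
  then have t': "t \<in> {1 / real m..T}" and y: "y \<in> cball 0 (real m)" using t m by auto
  have "(\<lambda>k. \<integral>\<^sup>+u. ennreal \<bar>q (r k) t y u - p t y u\<bar> \<partial>unit_lborel) \<longlonglongrightarrow> 0"
  proof (rule tendsto_sandwich[OF _ _ tendsto_const])
    show "(\<lambda>k. SUP y\<in>cball 0 (real m). SUP t\<in>{1 / real m..T}.
              \<integral>\<^sup>+u. ennreal \<bar>q (r k) t y u - p t y u\<bar> \<partial>unit_lborel) \<longlonglongrightarrow> 0"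
      using m by (intro R) simp
    show "\<forall>\<^sub>F k in sequentially. (\<integral>\<^sup>+u. ennreal \<bar>q (r k) t y u - p t y u\<bar> \<partial>unit_lborel)
        \<le> (SUP y\<in>cball 0 (real m). SUP t\<in>{1 / real m..T}.
              \<integral>\<^sup>+u. ennreal \<bar>q (r k) t y u - p t y u\<bar> \<partial>unit_lborel)"
      by (intro always_eventually allI SUP_upper2[OF y] SUP_upper2[OF t'] order_refl)
  qed auto
  with r show ?thesis by blast
qed

theorem theorem3p7:
  fixes T :: real
    and \<nu> :: "real \<Rightarrow> (real^'d) measure"
    and K :: "real \<Rightarrow> real measure"
    and b :: "real \<Rightarrow> real^'d \<Rightarrow> real \<Rightarrow> real^'d"
    and J :: "'j set" and A :: "'j \<Rightarrow> real set"
    and M :: "'\<omega> measure" and F :: "real \<Rightarrow> '\<omega> measure"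
    and W :: "real \<Rightarrow> '\<omega> \<Rightarrow> real^'d" and X\<^sub>0 :: "real \<Rightarrow> '\<omega> \<Rightarrow> real^'d"
    and X :: "nat \<Rightarrow> real \<Rightarrow> real \<Rightarrow> '\<omega> \<Rightarrow> real^'d"
    and q :: "nat \<Rightarrow> real \<Rightarrow> real^'d \<Rightarrow> real \<Rightarrow> real"
    and p :: "real \<Rightarrow> real^'d \<Rightarrow> real \<Rightarrow> real"
  assumes T_pos: "0 < T"
    and \<nu>_borel: "\<nu> \<in> measurable unit_borel (borel_of_topology (weak_topology UNIV))"
    and K_kernel: "interaction_kernel K"
    and H1: "\<exists>v\<^sub>0. (\<lambda>(u, x). v\<^sub>0 u x) \<in> borel_measurable (restrict_space borel ({0..1} \<times> UNIV)) \<and>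
        (\<forall>u\<in>{0..1}. \<forall>x. 0 \<le> v\<^sub>0 u x) \<and>
        (\<forall>u\<in>{0..1}. \<nu> u = density lborel (\<lambda>x. ennreal (v\<^sub>0 u x))) \<and>
        (\<exists>B. AE (u, x) in restrict_space lborel ({0..1} \<times> UNIV). v\<^sub>0 u x \<le> B)"
    and H2: "bounded_on_L1 K" "\<exists>\<alpha>\<^sub>0. 0 < \<alpha>\<^sub>0 \<and> \<alpha>\<^sub>0 \<le> 1 \<and> translation_continuous K \<alpha>\<^sub>0"
    and b_borel:
      "(\<lambda>(t, x, r). b t x r) \<in> borel_measurable (restrict_space borel ({0..T} \<times> UNIV \<times> UNIV))"
    and b_bounded:
      "\<exists>B. AE (t, x, r) in restrict_space lborel ({0..T} \<times> UNIV \<times> UNIV). norm (b t x r) \<le> B"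
    and b_hoelder: "\<exists>C \<alpha>. 0 < C \<and> 0 < \<alpha> \<and> \<alpha> \<le> 1 \<and>
        (\<forall>t\<in>{0..T}. \<forall>x r r'. norm (b t x r - b t x r') \<le> C * \<bar>r - r'\<bar> powr \<alpha>)"
    and J_countable: "countable J"
    and A_borel: "\<And>j. j \<in> J \<Longrightarrow> A j \<in> sets borel"
    and A_disjoint: "disjoint_family_on A J"
    and A_cover: "(\<Union>j\<in>J. A j) = {0..1}"
    and A_const: "\<And>j u v. j \<in> J \<Longrightarrow> u \<in> A j \<Longrightarrow> v \<in> A j \<Longrightarrow> \<nu> u = \<nu> v \<and> K u = K v"
    and basis: "usual_filtered_space M F" "wiener_process M F W"
    and X\<^sub>0_adapted: "\<And>u. u \<in> {0..1} \<Longrightarrow> X\<^sub>0 u \<in> borel_measurable (F 0)"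
    and X\<^sub>0_law: "\<And>u. u \<in> {0..1} \<Longrightarrow> distr M borel (X\<^sub>0 u) = \<nu> u"
    and X\<^sub>0_jointly: "(\<lambda>(u, \<omega>). X\<^sub>0 u \<omega>) \<in> borel_measurable (unit_borel \<Otimes>\<^sub>M M)"
    and euler: "\<And>N. 1 \<le> N \<Longrightarrow> euler_scheme M W X\<^sub>0 T b K N (X N) (q N)"
    and p_solution: "fp_solution T b K \<nu> p"
    and p_cont: "L1_continuous_on ({0<..T} \<times> UNIV) unit_lborel (\<lambda>(t, y). p t y)"
    and p_limit: "locally_uniform_euler_limit T q p"
  shows "(\<forall>t\<in>{0<..T}. \<forall>y. \<forall>j\<in>J.
            (\<integral>\<^sup>+u\<in>A j. (\<integral>\<^sup>+v\<in>A j. ennreal \<bar>p t y u - p t y v\<bar> \<partial>lborel) \<partial>lborel) = 0) \<and>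
         (\<forall>j\<in>J.
            L1_continuous_on ({0<..T} \<times> UNIV) (restrict_space lborel (A j)) (\<lambda>(t, y). p t y) \<and>
            (\<forall>t\<in>{0<..T}. \<forall>y. \<exists>c. AE u in restrict_space lborel (A j). p t y u = c))"
proof -
  have P: "borel_partition J A"
    using J_countable A_borel A_disjoint A_cover by (simp add: borel_partition_def)
  have K: "block_constant J A K" using A_const unfolding block_constant_def by blast
  have Ku: "K u \<in> unit_measures" if "u \<in> {0..1}" for u
    using interaction_kernel_unit_measures[OF K_kernel that] .
  have prob: "prob_space M" using basis(1) by (simp add: usual_filtered_space_def)
  have A01: "A j \<subseteq> {0..1}" if "j \<in> J" for j using A_cover that by blast
  \<comment> \<open>At time \<open>0\<close> no label is exceptional.\<close>
  have init: "block_law_process M (F 0) J A X\<^sub>0"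
  proof (rule block_law_processI[OF X\<^sub>0_jointly X\<^sub>0_adapted])
    fix j u v assume uv: "j \<in> J" "u \<in> A j - {}" "v \<in> A j - {}"
    have "\<nu> u = \<nu> v" using A_const[of j u v] uv by simp
    moreover have "u \<in> {0..1}" "v \<in> {0..1}" using uv A01 by blast+
    ultimately show "distr M borel (X\<^sub>0 u) = distr M borel (X\<^sub>0 v)" using X\<^sub>0_law by metis
  qed auto
  have const: "\<exists>c. AE u in restrict_space lborel (A j). p t y u = c" if t: "t \<in> {0<..T}" and j: "j \<in> J" for t y j
  proof -
    let ?R = "restrict_space lborel (A j)"
    obtain r where r: "\<And>k. 1 \<le> r k" "(\<lambda>k. \<integral>\<^sup>+u. ennreal \<bar>q (r k) t y u - p t y u\<bar> \<partial>unit_lborel) \<longlonglongrightarrow> 0"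
      using euler_limit_pointwise[OF p_limit, of t y] t by auto
    have cont: "L1_continuous_on ({0<..T} \<times> UNIV) ?R (\<lambda>(t, y). p t y)"
      by (rule L1_continuous_on_subset_domain[OF p_cont A_borel[OF j] _ A01[OF j]]) simp
    show ?thesis
    proof (rule AE_constant_L1_limit)
      have "emeasure lborel (A j) \<le> emeasure lborel {0..1::real}" by (intro emeasure_mono A01 j) simp
      also have "\<dots> < \<infinity>" by simp
      finally show "finite_measure ?R"
        using A_borel[OF j] by (intro finite_measureI) (simp add: space_restrict_space emeasure_restrict_space less_top[symmetric])
      show "p t y \<in> borel_measurable ?R"
      proof (rule borel_measurable_integrable)
        have "(t, y) \<in> {0<..T} \<times> UNIV" using t by simp
        then have "integrable ?R (case (t, y) of (t, y) \<Rightarrow> p t y)" using cont unfolding L1_continuous_on_def by blast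
        then show "integrable ?R (p t y)" by simp
      qed
      show "(\<lambda>k. \<integral>\<^sup>+u. ennreal \<bar>q (r k) t y u - p t y u\<bar> \<partial>?R) \<longlonglongrightarrow> 0"
      proof (rule tendsto_sandwich[OF _ _ tendsto_const r(2)])
        show "\<forall>\<^sub>F k in sequentially. (\<integral>\<^sup>+u. ennreal \<bar>q (r k) t y u - p t y u\<bar> \<partial>?R)
          \<le> (\<integral>\<^sup>+u. ennreal \<bar>q (r k) t y u - p t y u\<bar> \<partial>unit_lborel)"
        proof (intro always_eventually allI)
          fix k
          show "(\<integral>\<^sup>+u. ennreal \<bar>q (r k) t y u - p t y u\<bar> \<partial>?R) \<le> (\<integral>\<^sup>+u. ennreal \<bar>q (r k) t y u - p t y u\<bar> \<partial>unit_lborel)"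
            using A_borel[OF j] A01[OF j]
            by (auto simp: nn_integral_restrict_space indicator_def intro!: nn_integral_mono)
        qed
      qed auto
      show "\<exists>c. AE u in ?R. q (r k) t y u = c" for k
      proof (rule block_law_process_density_constant[OF prob _ P])
        show "subalgebra M (F t)"
          using basis(1) t unfolding usual_filtered_space_def by (meson greaterThanAtMost_iff less_imp_le)
        show "block_law_process M (F t) J A (X (r k) t)"
          using t
          by (intro euler_scheme_block_law[OF T_pos r(1) P K Ku H2(1) b_borel basis init euler[OF r(1)]])
            auto
        show "continuous_on UNIV (\<lambda>x. q (r k) t x w)" "\<And>x. 0 \<le> q (r k) t x w"
            "distr M borel (X (r k) t w) = density lborel (\<lambda>x. ennreal (q (r k) t x w))"
          if "w \<in> {0..1}" for w
          using euler[OF r(1)[of k]] t that unfolding euler_scheme_def Let_def by blast+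
      qed (rule j)
    qed
  qed
  have "(\<integral>\<^sup>+u\<in>A j. (\<integral>\<^sup>+v\<in>A j. ennreal \<bar>p t y u - p t y v\<bar> \<partial>lborel) \<partial>lborel) = 0"
    if t: "t \<in> {0<..T}" and j: "j \<in> J" for t y j
  proof -
    obtain c where "AE u in restrict_space lborel (A j). p t y u = c" using const[OF t j] by blast
    then have c: "AE u in lborel. u \<in> A j \<longrightarrow> p t y u = c" using A_borel[OF j] by (simp add: AE_restrict_space_iff)
    have inner: "(\<integral>\<^sup>+v\<in>A j. ennreal \<bar>c - p t y v\<bar> \<partial>lborel) = (\<integral>\<^sup>+v. 0 \<partial>(lborel :: real measure))"
      by (intro nn_integral_cong_AE) (use c in \<open>eventually_elim, auto split: split_indicator\<close>)
    have "(\<integral>\<^sup>+u\<in>A j. (\<integral>\<^sup>+v\<in>A j. ennreal \<bar>p t y u - p t y v\<bar> \<partial>lborel) \<partial>lborel) = (\<integral>\<^sup>+u. 0 \<partial>(lborel :: real measure))"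
    proof (intro nn_integral_cong_AE)
      show "AE u in lborel. (\<integral>\<^sup>+v\<in>A j. ennreal \<bar>p t y u - p t y v\<bar> \<partial>lborel) * indicator (A j) u = 0"
        using c by eventually_elim (use inner in \<open>auto split: split_indicator\<close>)
    qed
    then show ?thesis by simp
  qed
  moreover have "L1_continuous_on ({0<..T} \<times> UNIV) (restrict_space lborel (A j)) (\<lambda>(t, y). p t y)" if "j \<in> J" for j
    by (rule L1_continuous_on_subset_domain[OF p_cont A_borel[OF that] _ A01[OF that]]) simp
  ultimately show ?thesis using const by blast
qed

end
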